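(* (Hölder inequality) Let $p_1,\dots,p_n\in(1,\infty)$ with $\sum_{k=1}^np_k^{-1}=1$, and let $A$ be a weighted geometric mean closed Archimedean $\Phi$-algebra over $\mathbb{K}$. (1) If $B$ is also a weighted geometric mean closed Archimedean $\Phi$-algebra over $\mathbb{K}$ and $T\colon A\to B$ is a positive linear map, then for all $a_1,\dots,a_n\in A$: $T\bigl(\prod_{k=1}^n|a_k|\bigr)\le\prod_{k=1}^n\bigl(T(|a_k|^{p_k})\bigr)^{1/p_k}$. (2) If $B$ is a weighted geometric mean closed Archimedean vector lattice over $\mathbb{K}$ and $T\colon A\to B$ is a positive linear map, then for all $a_1,\dots,a_n\in A$: $T\bigl(\prod_{k=1}^n|a_k|\bigr)\le\triangle_{k=1}^n\bigl(T(|a_k|^{p_k}),1/p_k\bigr)$.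
   Context: $\mathbb{K}$ denotes $\mathbb{R}$ or $\mathbb{C}$. An Archimedean vector lattice over $\mathbb{C}$ is $E+iE$ where $E$ is an Archimedean real vector lattice in which $\sup\{(\cos\theta)f+(\sin\theta)g:\theta\in[0,2\pi]\}$ exists for all $f,g$, with modulus $|f+ig|$ equal to that supremum; over $\mathbb{R}$ it is an Archimedean real vector lattice with $|f|=f\vee(-f)$. $E^+=\{f:|f|=f\}$, $E_\rho=E^+-E^+$ with its real lattice order. $E$ is weighted geometric mean closed if for all $f_1,\dots,f_n\in E$, $r_k\in(0,1)$ with $\sum r_k=1$, $\triangle_{k=1}^n(f_k,r_k):=\inf\{\sum_{k=1}^n r_k\theta_k|f_k|:\theta_k\in(0,\infty),\ \prod_k\theta_k^{r_k}=1\}$ exists in $E$. An Archimedean $\Phi$-algebra over $\mathbb{K}$: $A_\rho$ is an $f$-algebra with multiplicative identity $e$ (multiplication extended complex-bilinearly in the complex case). For $a\in A^+$ and $r\in(0,\infty)$, with $\lfloor r\rfloor=\max\{n\in\mathbb{N}\cup\{0\}:n\le r\}$ and $\tilde r=r-\lfloor r\rfloor$, $a^r=a^{\lfloor r\rfloor}\inf\{\tilde r\theta_1a+(1-\tilde r)\theta_2e:\theta_1,\theta_2>0,\ \theta_1^{\tilde r}\theta_2^{1-\tilde r}=1\}$, with $a^0=e$ and the infimum taken to be $e$ when $\tilde r=0$. A linear map $T$ is positive if $T(A^+)\subseteq B^+$. *)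

theory Defs
  imports Complex_Main
begin

definition vl_abs :: "'a::{ordered_real_vector,lattice} \<Rightarrow> 'a" where
  "vl_abs x = sup x (- x)"

definition vl_is_sup :: "'a::order set \<Rightarrow> 'a \<Rightarrow> bool" where
  "vl_is_sup S x \<longleftrightarrow> (\<forall>s\<in>S. s \<le> x) \<and> (\<forall>z. (\<forall>s\<in>S. s \<le> z) \<longrightarrow> x \<le> z)"

definition vl_is_inf :: "'a::order set \<Rightarrow> 'a \<Rightarrow> bool" where
  "vl_is_inf S x \<longleftrightarrow> (\<forall>s\<in>S. x \<le> s) \<and> (\<forall>z. (\<forall>s\<in>S. z \<le> s) \<longrightarrow> z \<le> x)"

definition vl_Sup :: "'a::order set \<Rightarrow> 'a" where
  "vl_Sup S = (THE x. vl_is_sup S x)"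

definition vl_Inf :: "'a::order set \<Rightarrow> 'a" where
  "vl_Inf S = (THE x. vl_is_inf S x)"

definition archimedean_vl :: "'a::{ordered_real_vector,lattice} itself \<Rightarrow> bool" where
  "archimedean_vl _ \<longleftrightarrow>
     (\<forall>x y::'a. 0 \<le> x \<and> (\<forall>n::nat. real n *\<^sub>R x \<le> y) \<longrightarrow> x = 0)"

definition wgm_set_R :: "nat \<Rightarrow> (nat \<Rightarrow> 'a::{ordered_real_vector,lattice}) \<Rightarrow> (nat \<Rightarrow> real) \<Rightarrow> 'a set" where
  "wgm_set_R n f r = {(\<Sum>k<n. (r k * \<theta> k) *\<^sub>R vl_abs (f k)) | \<theta>.
       (\<forall>k<n. 0 < \<theta> k) \<and> (\<Prod>k<n. \<theta> k powr r k) = 1}"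

definition wgm_R :: "nat \<Rightarrow> (nat \<Rightarrow> 'a::{ordered_real_vector,lattice}) \<Rightarrow> (nat \<Rightarrow> real) \<Rightarrow> 'a" where
  "wgm_R n f r = vl_Inf (wgm_set_R n f r)"

definition wgm_closed_R :: "'a::{ordered_real_vector,lattice} itself \<Rightarrow> bool" where
  "wgm_closed_R _ \<longleftrightarrow>
     (\<forall>n (f::nat \<Rightarrow> 'a) r. (\<forall>k<n. 0 < r k \<and> r k < 1) \<and> (\<Sum>k<n. r k) = 1
        \<longrightarrow> (\<exists>x. vl_is_inf (wgm_set_R n f r) x))"

definition phi_algebra_R :: "'a::{ordered_real_vector,lattice,real_algebra,monoid_mult} itself \<Rightarrow> bool" where
  "phi_algebra_R _ \<longleftrightarrow> archimedean_vl TYPE('a) \<and>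
     (\<forall>a b::'a. 0 \<le> a \<and> 0 \<le> b \<longrightarrow> 0 \<le> a * b) \<and>
     (\<forall>a b c::'a. inf a b = 0 \<and> 0 \<le> c \<longrightarrow> inf (a * c) b = 0 \<and> inf (c * a) b = 0)"

(* a^r for a \<ge> 0, r > 0 *)
definition vl_pow :: "'a::{ordered_real_vector,lattice,real_algebra,monoid_mult} \<Rightarrow> real \<Rightarrow> 'a" where
  "vl_pow a r = a ^ nat \<lfloor>r\<rfloor> *
     (if frac r = 0 then 1
      else vl_Inf {(frac r * \<theta>1) *\<^sub>R a + ((1 - frac r) * \<theta>2) *\<^sub>R 1 | \<theta>1 \<theta>2.
              0 < \<theta>1 \<and> 0 < \<theta>2 \<and> \<theta>1 powr frac r * \<theta>2 powr (1 - frac r) = 1})"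

definition positive_R :: "('a::{ordered_real_vector,lattice} \<Rightarrow> 'b::{ordered_real_vector,lattice}) \<Rightarrow> bool" where
  "positive_R T \<longleftrightarrow> (\<forall>x. vl_abs x = x \<longrightarrow> vl_abs (T x) = T x)"

(* ===== Complex Archimedean vector lattices E + iE, represented as pairs (f,g) = f + i g ===== *)

definition c_add :: "'a::{ordered_real_vector,lattice} \<times> 'a \<Rightarrow> 'a \<times> 'a \<Rightarrow> 'a \<times> 'a" where
  "c_add x y = (fst x + fst y, snd x + snd y)"

definition c_sub :: "'a::{ordered_real_vector,lattice} \<times> 'a \<Rightarrow> 'a \<times> 'a \<Rightarrow> 'a \<times> 'a" where
  "c_sub x y = (fst x - fst y, snd x - snd y)"

definition c_scaleR :: "real \<Rightarrow> 'a::{ordered_real_vector,lattice} \<times> 'a \<Rightarrow> 'a \<times> 'a" where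
  "c_scaleR t x = (t *\<^sub>R fst x, t *\<^sub>R snd x)"

definition c_smul :: "complex \<Rightarrow> 'a::{ordered_real_vector,lattice} \<times> 'a \<Rightarrow> 'a \<times> 'a" where
  "c_smul c x = (Re c *\<^sub>R fst x - Im c *\<^sub>R snd x, Im c *\<^sub>R fst x + Re c *\<^sub>R snd x)"

definition c_sum :: "(nat \<Rightarrow> 'a::{ordered_real_vector,lattice} \<times> 'a) \<Rightarrow> nat \<Rightarrow> 'a \<times> 'a" where
  "c_sum h n = ((\<Sum>k<n. fst (h k)), (\<Sum>k<n. snd (h k)))"

definition c_abs :: "'a::{ordered_real_vector,lattice} \<times> 'a \<Rightarrow> 'a \<times> 'a" where
  "c_abs x = (vl_Sup {cos t *\<^sub>R fst x + sin t *\<^sub>R snd x | t. 0 \<le> t \<and> t \<le> 2 * pi}, 0)"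

definition complex_vl :: "'a::{ordered_real_vector,lattice} itself \<Rightarrow> bool" where
  "complex_vl _ \<longleftrightarrow> archimedean_vl TYPE('a) \<and>
     (\<forall>f g::'a. \<exists>s. vl_is_sup {cos t *\<^sub>R f + sin t *\<^sub>R g | t. 0 \<le> t \<and> t \<le> 2 * pi} s)"

definition c_pos :: "'a::{ordered_real_vector,lattice} \<times> 'a \<Rightarrow> bool" where
  "c_pos x \<longleftrightarrow> c_abs x = x"

definition c_le :: "'a::{ordered_real_vector,lattice} \<times> 'a \<Rightarrow> 'a \<times> 'a \<Rightarrow> bool" where
  "c_le x y \<longleftrightarrow> c_pos (c_sub y x)"

definition c_is_inf :: "('a::{ordered_real_vector,lattice} \<times> 'a) set \<Rightarrow> 'a \<times> 'a \<Rightarrow> bool" where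
  "c_is_inf S x \<longleftrightarrow> (\<forall>s\<in>S. c_le x s) \<and> (\<forall>z. (\<forall>s\<in>S. c_le z s) \<longrightarrow> c_le z x)"

definition c_Inf :: "('a::{ordered_real_vector,lattice} \<times> 'a) set \<Rightarrow> 'a \<times> 'a" where
  "c_Inf S = (THE x. c_is_inf S x)"

definition wgm_set_C :: "nat \<Rightarrow> (nat \<Rightarrow> 'a::{ordered_real_vector,lattice} \<times> 'a) \<Rightarrow> (nat \<Rightarrow> real) \<Rightarrow> ('a \<times> 'a) set" where
  "wgm_set_C n f r = {c_sum (\<lambda>k. c_scaleR (r k * \<theta> k) (c_abs (f k))) n | \<theta>.
       (\<forall>k<n. 0 < \<theta> k) \<and> (\<Prod>k<n. \<theta> k powr r k) = 1}"

definition wgm_C :: "nat \<Rightarrow> (nat \<Rightarrow> 'a::{ordered_real_vector,lattice} \<times> 'a) \<Rightarrow> (nat \<Rightarrow> real) \<Rightarrow> 'a \<times> 'a" where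
  "wgm_C n f r = c_Inf (wgm_set_C n f r)"

definition wgm_closed_C :: "'a::{ordered_real_vector,lattice} itself \<Rightarrow> bool" where
  "wgm_closed_C _ \<longleftrightarrow>
     (\<forall>n (f::nat \<Rightarrow> 'a \<times> 'a) r. (\<forall>k<n. 0 < r k \<and> r k < 1) \<and> (\<Sum>k<n. r k) = 1
        \<longrightarrow> (\<exists>x. c_is_inf (wgm_set_C n f r) x))"

definition c_linear :: "('a::{ordered_real_vector,lattice} \<times> 'a \<Rightarrow> 'b::{ordered_real_vector,lattice} \<times> 'b) \<Rightarrow> bool" where
  "c_linear T \<longleftrightarrow> (\<forall>x y. T (c_add x y) = c_add (T x) (T y)) \<and> (\<forall>c x. T (c_smul c x) = c_smul c (T x))"

definition c_positive :: "('a::{ordered_real_vector,lattice} \<times> 'a \<Rightarrow> 'b::{ordered_real_vector,lattice} \<times> 'b) \<Rightarrow> bool" where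
  "c_positive T \<longleftrightarrow> (\<forall>x. c_pos x \<longrightarrow> c_pos (T x))"

(* complex-bilinear extension of the multiplication of A_rho; identity e = (1,0) *)
definition c_mul :: "'a::{ordered_real_vector,lattice,real_algebra,monoid_mult} \<times> 'a \<Rightarrow> 'a \<times> 'a \<Rightarrow> 'a \<times> 'a" where
  "c_mul x y = (fst x * fst y - snd x * snd y, fst x * snd y + snd x * fst y)"

definition c_one :: "'a::{ordered_real_vector,lattice,real_algebra,monoid_mult} \<times> 'a" where
  "c_one = (1, 0)"

definition c_prod_list :: "('a::{ordered_real_vector,lattice,real_algebra,monoid_mult} \<times> 'a) list \<Rightarrow> 'a \<times> 'a" where
  "c_prod_list xs = foldr c_mul xs c_one"

definition c_power :: "'a::{ordered_real_vector,lattice,real_algebra,monoid_mult} \<times> 'a \<Rightarrow> nat \<Rightarrow> 'a \<times> 'a" where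
  "c_power a m = (c_mul a ^^ m) c_one"

definition c_pow :: "'a::{ordered_real_vector,lattice,real_algebra,monoid_mult} \<times> 'a \<Rightarrow> real \<Rightarrow> 'a \<times> 'a" where
  "c_pow a r = c_mul (c_power a (nat \<lfloor>r\<rfloor>))
     (if frac r = 0 then c_one
      else c_Inf {c_add (c_scaleR (frac r * \<theta>1) a) (c_scaleR ((1 - frac r) * \<theta>2) c_one) | \<theta>1 \<theta>2.
              0 < \<theta>1 \<and> 0 < \<theta>2 \<and> \<theta>1 powr frac r * \<theta>2 powr (1 - frac r) = 1})"

definition phi_algebra_C :: "'a::{ordered_real_vector,lattice,real_algebra,monoid_mult} itself \<Rightarrow> bool" where
  "phi_algebra_C _ \<longleftrightarrow> phi_algebra_R TYPE('a) \<and> complex_vl TYPE('a)"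

end

theory Submission
  imports Defs
begin

text \<open>
  Everything reduces to two inequalities: the weighted AM-GM (Young) inequality
  \<open>\<Prod> b\<^sub>k \<le> \<Sum> (\<theta>\<^sub>k / p\<^sub>k) b\<^sub>k\<^bsup>p\<^sub>k\<^esup>\<close> in \<open>A\<close>, to which \<open>T\<close> is applied, and the fact that in \<open>B\<close>
  a lower bound of all sums \<open>\<Sum> r\<^sub>k \<theta>\<^sub>k c\<^sub>k\<close> lies below \<open>\<Prod> c\<^sub>k\<^bsup>r\<^sub>k\<^esup>\<close>.
  Both follow from the corresponding inequalities between real numbers without any representation
  theorem. Say that \<open>y \<ge> 0\<close> holds on \<open>f > 0\<close> if the negative part of \<open>y\<close> is disjoint from \<open>f\<close>.
  By the Archimedean property every \<open>f > 0\<close> dominates some \<open>f' > 0\<close> on which given elements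
  \<open>c\<^sub>k \<ge> 0\<close> lie in prescribed short intervals with real endpoints, and an inequality that holds,
  up to an arbitrary \<open>\<epsilon> > 0\<close>, on some \<open>f'\<close> below every \<open>f\<close> holds globally.
\<close>

section \<open>Negative parts, disjointness and local nonnegativity in a vector lattice\<close>

text \<open>The positive part of \<open>y\<close> gets no name of its own; it is written
  \<open>npart (- y)\<close>.\<close>

definition npart :: "'a::{ordered_real_vector,lattice} \<Rightarrow> 'a" where
  "npart y = sup (- y) 0"

lemma npart_nonneg: "0 \<le> npart y"
  by (simp add: npart_def)

lemma npart_antimono: "y \<le> z \<Longrightarrow> npart z \<le> npart y"
  unfolding npart_def by (rule sup_mono) auto

lemma npart_eq_0_iff: "npart y = 0 \<longleftrightarrow> 0 \<le> y"
  by (metis npart_def neg_le_0_iff_le sup.cobounded1 sup.absorb2)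

lemma npart_add_le: "npart (y + z) \<le> npart y + npart z"
proof -
  have "- y + - z \<le> sup (- y) 0 + sup (- z) 0"
    by (intro add_mono) auto
  then show ?thesis
    unfolding npart_def by (intro sup_least) (auto simp: add_nonneg_nonneg)
qed

lemma npart_scaleR_le:
  assumes "0 \<le> c" shows "npart (c *\<^sub>R y) \<le> c *\<^sub>R npart y"
proof -
  have "c *\<^sub>R (- y) \<le> c *\<^sub>R npart y"
    using assms by (intro scaleR_left_mono) (auto simp: npart_def)
  then show ?thesis
    unfolding npart_def[of "c *\<^sub>R y"] using assms npart_nonneg[of y]
    by (intro sup_least) (auto intro: scaleR_nonneg_nonneg)
qed

lemma ppart_minus_npart: "npart (- y) - npart y = (y::'a::{ordered_real_vector,lattice})"
proof (rule antisym)
  have "y \<le> npart y + y"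
    using npart_nonneg[of y] by simp
  moreover have "0 \<le> npart y + y"
    using add_right_mono[of "- y" "npart y" y] by (simp add: npart_def)
  ultimately have "npart (- y) \<le> npart y + y"
    unfolding npart_def[of "- y"] by simp
  then show "npart (- y) - npart y \<le> y"
    by (simp add: algebra_simps)
  have "- y \<le> npart (- y) - y"
    using npart_nonneg[of "- y"] by simp
  moreover have "0 \<le> npart (- y) - y"
    by (simp add: npart_def)
  ultimately have "npart y \<le> npart (- y) - y"
    unfolding npart_def[of y] by simp
  then show "y \<le> npart (- y) - npart y"
    by (simp add: algebra_simps)
qed

text \<open>Subtracting the infimum from \<open>npart y\<close> leaves an upper bound of both
  \<open>- y\<close> and 0, because \<open>npart (- y) = npart y + y\<close>. Minimality of
  \<open>npart y\<close> then forces the infimum to be at most 0.\<close>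

lemma inf_npart_uminus: "inf (npart y) (npart (- y)) = 0"
proof (rule antisym)
  let ?w = "inf (npart y) (npart (- y))"
  have "?w \<le> npart y" "?w \<le> npart (- y)" by auto
  moreover have "npart (- y) = npart y + y"
    using ppart_minus_npart[of y] by (metis add.commute diff_add_cancel)
  ultimately have "- y \<le> npart y - ?w" "0 \<le> npart y - ?w"
    by (auto simp: algebra_simps)
  then have "npart y \<le> npart y - ?w"
    by (subst (1) npart_def) (rule sup_least)
  then show "?w \<le> 0" by simp
qed (simp add: npart_nonneg)

lemma disjoint_mono:
  fixes f u :: "'a::{ordered_real_vector,lattice}"
  assumes "inf f u = 0" "0 \<le> f'" "f' \<le> f" "0 \<le> v" "v \<le> u"
  shows "inf f' v = 0"
  using inf_mono[OF assms(3,5)] assms by (intro antisym) auto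

text \<open>For \<open>w = inf f (u + v)\<close>, the element \<open>w - u\<close> lies below both
  \<open>f\<close> and \<open>v\<close>, hence below 0. So \<open>w\<close> lies below
  \<open>f\<close> and \<open>u\<close>.\<close>

lemma disjoint_add:
  fixes f u v :: "'a::{ordered_real_vector,lattice}"
  assumes "inf f u = 0" "inf f v = 0"
  shows "inf f (u + v) = 0"
proof (rule antisym)
  have nn: "0 \<le> f" "0 \<le> u" "0 \<le> v"
    using assms by (metis inf.cobounded1 inf.cobounded2)+
  let ?w = "inf f (u + v)"
  have "?w \<le> u + v" by simp
  then have "?w - u \<le> v" by (simp add: algebra_simps)
  moreover have "?w - u \<le> ?w"
    using diff_left_mono[OF nn(2), of ?w] by (simp only: diff_zero)
  then have "?w - u \<le> f" by (rule order_trans) simp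
  ultimately have "?w - u \<le> inf f v" by simp
  then have "?w \<le> u" using assms by simp
  then have "?w \<le> inf f u" by simp
  then show "?w \<le> 0" using assms by simp
  show "0 \<le> ?w" using nn by simp
qed

lemma disjoint_scaleR:
  fixes f u :: "'a::{ordered_real_vector,lattice}"
  assumes "inf f u = 0" "0 \<le> c"
  shows "inf f (c *\<^sub>R u) = 0"
proof (rule antisym)
  have nn: "0 \<le> f" "0 \<le> u"
    using assms by (metis inf.cobounded1 inf.cobounded2)+
  \<comment> \<open>Dividing by \<open>max 1 c\<close> instead of \<open>c\<close> keeps the factor
    at most 1, so that the bound by \<open>f\<close> survives, and covers
    \<open>c = 0\<close>.\<close>
  let ?w = "inf f (c *\<^sub>R u)" and ?d = "inverse (max 1 c)"
  show w0: "0 \<le> ?w" using nn assms(2) by (simp add: scaleR_nonneg_nonneg)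
  have "?d *\<^sub>R ?w \<le> 1 *\<^sub>R ?w"
    using w0 by (intro scaleR_right_mono) (auto simp: inverse_le_1_iff)
  then have 1: "?d *\<^sub>R ?w \<le> f"
    by (simp add: le_infI1)
  have "?d *\<^sub>R ?w \<le> ?d *\<^sub>R (c *\<^sub>R u)"
    by (intro scaleR_left_mono) auto
  also have "\<dots> = (?d * c) *\<^sub>R u" by simp
  also have "\<dots> \<le> 1 *\<^sub>R u"
    using nn assms(2) by (intro scaleR_right_mono) (auto simp: field_simps max_def)
  finally have "?d *\<^sub>R ?w \<le> inf f u" using 1 by simp
  then have "?d *\<^sub>R ?w \<le> 0" using assms by simp
  then have "max 1 c *\<^sub>R (?d *\<^sub>R ?w) \<le> max 1 c *\<^sub>R 0"
    by (intro scaleR_left_mono) auto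
  then show "?w \<le> 0" by simp
qed

text \<open>\<open>nonneg_on f y\<close> says that \<open>y \<ge> 0\<close> on the support of \<open>f\<close> when elements are viewed as functions.\<close>

definition nonneg_on :: "'a::{ordered_real_vector,lattice} \<Rightarrow> 'a \<Rightarrow> bool" where
  "nonneg_on f y \<longleftrightarrow> inf f (npart y) = 0"

lemma nonneg_on_nonneg: "0 \<le> f \<Longrightarrow> 0 \<le> y \<Longrightarrow> nonneg_on f y"
  using npart_eq_0_iff[of y] by (simp add: nonneg_on_def inf_absorb2)

lemma nonneg_on_subset: "nonneg_on f y \<Longrightarrow> 0 \<le> f' \<Longrightarrow> f' \<le> f \<Longrightarrow> nonneg_on f' y"
  unfolding nonneg_on_def by (erule disjoint_mono) (auto simp: npart_nonneg)

lemma nonneg_on_base: "nonneg_on f y \<Longrightarrow> 0 \<le> f"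
  unfolding nonneg_on_def by (metis inf.cobounded1)

lemma nonneg_on_mono: "nonneg_on f y \<Longrightarrow> y \<le> z \<Longrightarrow> nonneg_on f z"
  using disjoint_mono[of f "npart y" f "npart z"] nonneg_on_base[of f y]
  by (simp add: nonneg_on_def npart_nonneg npart_antimono)

lemma nonneg_on_add: "nonneg_on f y \<Longrightarrow> nonneg_on f z \<Longrightarrow> nonneg_on f (y + z)"
  using disjoint_mono[OF disjoint_add, of f "npart y" "npart z" f] nonneg_on_base[of f y]
  by (simp add: nonneg_on_def npart_nonneg npart_add_le)

lemma nonneg_on_scaleR: "nonneg_on f y \<Longrightarrow> 0 \<le> c \<Longrightarrow> nonneg_on f (c *\<^sub>R y)"
  using disjoint_mono[OF disjoint_scaleR, of f "npart y" c f] nonneg_on_base[of f y]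
  by (simp add: nonneg_on_def npart_nonneg npart_scaleR_le)

lemma nonneg_on_sum:
  assumes "0 \<le> f" "\<And>k. k \<in> I \<Longrightarrow> nonneg_on f (y k)"
  shows "nonneg_on f (\<Sum>k\<in>I. y k)"
  using assms(2) by (induction I rule: infinite_finite_induct)
    (auto intro: nonneg_on_add nonneg_on_nonneg assms(1))

text \<open>Truncation from above at 0 does not enlarge the negative part. This serves the truncated
  minorant used for roots.\<close>

lemma nonneg_on_inf_0:
  fixes y :: "'a::{ordered_real_vector,lattice}"
  assumes "nonneg_on f y" shows "nonneg_on f (inf y 0)"
proof -
  have "- npart y \<le> inf y 0"
    by (simp add: npart_def neg_le_iff_le minus_le_iff)
  then have "npart (inf y 0) \<le> npart y"
    unfolding npart_def[of "inf y 0"] by (simp add: npart_nonneg minus_le_iff)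
  then show ?thesis
    using assms disjoint_mono[of f "npart y" f "npart (inf y 0)"] nonneg_on_base[OF assms]
    by (simp add: nonneg_on_def npart_nonneg)
qed

text \<open>The replacement for totality of the order: after shrinking \<open>f\<close>, every element has a sign.\<close>

lemma nonneg_on_cases:
  fixes y :: "'a::{ordered_real_vector,lattice}"
  assumes "0 < f"
  obtains "nonneg_on f y" | f' where "0 < f'" "f' \<le> f" "nonneg_on f' (- y)"
proof (cases "nonneg_on f y")
  case False
  \<comment> \<open>This infimum is nonzero exactly because \<open>nonneg_on f y\<close> fails, and
    it lies below \<open>npart y\<close>, which is disjoint from \<open>npart (- y)\<close>.\<close>
  let ?f = "inf f (npart y)"
  have "0 \<le> ?f" using assms by (simp add: npart_nonneg)
  moreover have "nonneg_on ?f (- y)"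
    unfolding nonneg_on_def using inf_npart_uminus[of y] calculation
    by (intro disjoint_mono[of "npart y" _ ?f]) (auto simp: npart_nonneg)
  ultimately show ?thesis
    using False that(2)[of ?f] by (auto simp: nonneg_on_def less_le)
qed (use that in auto)

section \<open>Localisation in Phi-algebras\<close>

lemma phi_mult_nonneg:
  fixes a b :: "'a::{ordered_real_vector,lattice,real_algebra,monoid_mult}"
  assumes "phi_algebra_R TYPE('a)" "0 \<le> a" "0 \<le> b"
  shows "0 \<le> a * b"
  using assms by (auto simp: phi_algebra_R_def)

lemma phi_disjoint_mult:
  fixes a b c :: "'a::{ordered_real_vector,lattice,real_algebra,monoid_mult}"
  assumes "phi_algebra_R TYPE('a)" "inf a b = 0" "0 \<le> c"
  shows "inf a (b * c) = 0" "inf a (c * b) = 0"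
  using assms unfolding phi_algebra_R_def by (metis inf.commute)+

text \<open>The f-algebra axiom applied twice: \<open>a * b\<close> is disjoint from
  \<open>a\<close>, hence from \<open>a * b\<close> itself.\<close>

lemma phi_disjoint_mult_0:
  fixes a b :: "'a::{ordered_real_vector,lattice,real_algebra,monoid_mult}"
  assumes phi: "phi_algebra_R TYPE('a)" and ab: "inf a b = 0"
  shows "a * b = 0"
proof -
  have nn: "0 \<le> a" "0 \<le> b"
    using ab by (metis inf.cobounded1 inf.cobounded2)+
  have "inf a (a * b) = 0"
    using phi_disjoint_mult(2)[OF phi ab nn(1)] .
  then have "inf (a * b) (a * b) = 0"
    using phi_disjoint_mult(1)[OF phi _ nn(2), of "a * b" a] by (simp add: inf.commute)
  then show ?thesis by simp
qed

text \<open>With \<open>N\<close> the negative part of 1 and \<open>P\<close> its positive part, N =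
  N * 1 = N * (P - N) = - N * N, which is at most 0.\<close>

lemma phi_one_nonneg:
  assumes phi: "phi_algebra_R TYPE('a::{ordered_real_vector,lattice,real_algebra,monoid_mult})"
  shows "0 \<le> (1::'a)"
proof -
  let ?N = "npart (1::'a)"
  have "?N = ?N * (npart (- 1) - ?N)"
    by (simp only: ppart_minus_npart mult_1_right)
  also have "\<dots> = - (?N * ?N)"
    using phi_disjoint_mult_0[OF phi inf_npart_uminus[of "1::'a"]] by (simp add: right_diff_distrib)
  also have "\<dots> \<le> 0"
    using phi_mult_nonneg[OF phi] by (simp add: npart_nonneg)
  finally have "?N = 0" using npart_nonneg[of "1::'a"] by (rule antisym)
  then show ?thesis by (simp add: npart_eq_0_iff)
qed

lemma phi_power_nonneg:
  fixes a :: "'a::{ordered_real_vector,lattice,real_algebra,monoid_mult}"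
  assumes phi: "phi_algebra_R TYPE('a)" and "0 \<le> a"
  shows "0 \<le> a ^ m"
  by (induction m) (auto intro: phi_mult_nonneg phi_one_nonneg phi assms(2))

lemma phi_mult_mono:
  fixes a :: "'a::{ordered_real_vector,lattice,real_algebra,monoid_mult}"
  assumes phi: "phi_algebra_R TYPE('a)" and "a \<le> b" "0 \<le> c"
  shows "c * a \<le> c * b" "a * c \<le> b * c"
  using phi_mult_nonneg[OF phi, of c "b - a"] phi_mult_nonneg[OF phi, of "b - a" c] assms
  by (auto simp: algebra_simps)

text \<open>The negative part of \<open>y * c\<close> is at most \<open>npart y * c\<close>, and
  multiplication by \<open>c\<close> preserves disjointness from \<open>f\<close>.\<close>

lemma nonneg_on_mult:
  fixes y :: "'a::{ordered_real_vector,lattice,real_algebra,monoid_mult}"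
  assumes phi: "phi_algebra_R TYPE('a)" and y: "nonneg_on f y" and c: "0 \<le> c"
  shows "nonneg_on f (y * c)" "nonneg_on f (c * y)"
proof -
  have le: "- npart y \<le> y"
    by (simp add: npart_def minus_le_iff)
  have "npart (y * c) \<le> npart y * c" "npart (c * y) \<le> c * npart y"
    unfolding npart_def[of "y * c"] npart_def[of "c * y"]
    using phi_mult_mono[OF phi le c] phi_mult_nonneg[OF phi, of "npart y" c]
      phi_mult_nonneg[OF phi, of c "npart y"] c
    by (auto simp: npart_nonneg minus_le_iff)
  then show "nonneg_on f (y * c)" "nonneg_on f (c * y)"
    using disjoint_mono[OF phi_disjoint_mult(1)[OF phi y[unfolded nonneg_on_def] c]]
      disjoint_mono[OF phi_disjoint_mult(2)[OF phi y[unfolded nonneg_on_def] c]]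
      nonneg_on_base[OF y] by (auto simp: nonneg_on_def npart_nonneg)
qed

text \<open>A negative constant would make 1 disjoint from \<open>f\<close>, hence
  \<open>1 * f\<close> disjoint from \<open>f\<close>, which is absurd for \<open>f > 0\<close>.
  Thus comparing constants on any positive element compares real numbers.\<close>

lemma nonneg_on_const:
  fixes f :: "'a::{ordered_real_vector,lattice,real_algebra,monoid_mult}"
  assumes phi: "phi_algebra_R TYPE('a)" and f: "0 < f" "nonneg_on f (c *\<^sub>R 1)"
  shows "0 \<le> c"
proof (rule ccontr)
  assume "\<not> 0 \<le> c"
  then have "(1 / - c) *\<^sub>R (c *\<^sub>R (1::'a)) = - 1" by simp
  moreover have "nonneg_on f ((1 / - c) *\<^sub>R (c *\<^sub>R 1))"
    using f \<open>\<not> 0 \<le> c\<close> by (intro nonneg_on_scaleR[where y = "c *\<^sub>R 1"]) auto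
  ultimately have "nonneg_on f (- 1)" by simp
  then have "inf f 1 = 0"
    using phi_one_nonneg[OF phi] by (simp add: nonneg_on_def npart_def sup_absorb1)
  from phi_disjoint_mult(1)[OF phi this, of f] f show False by (simp add: less_le)
qed

text \<open>If no piece of \<open>f\<close> carried a bound, then \<open>y\<close> would be at least
  \<open>N\<close> on all of \<open>f\<close> for each \<open>N\<close>. Multiplying by
  \<open>f\<close> gives \<open>N\<close> times \<open>f\<close> below \<open>f * y\<close> for
  every \<open>N\<close>, against the Archimedean property.\<close>

lemma ex_bounded_on:
  fixes f :: "'a::{ordered_real_vector,lattice,real_algebra,monoid_mult}"
  assumes phi: "phi_algebra_R TYPE('a)" and f: "0 < f"
  shows "\<exists>f' N. 0 < f' \<and> f' \<le> f \<and> nonneg_on f' (real N *\<^sub>R 1 - y)"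
proof (rule ccontr)
  assume neg: "\<not> ?thesis"
  have "real N *\<^sub>R f \<le> f * y" for N
  proof -
    let ?z = "y - real N *\<^sub>R 1"
    have "nonneg_on f ?z"
      using neg nonneg_on_cases[OF f, of ?z] by (metis minus_diff_eq)
    \<comment> \<open>Multiplication by \<open>f\<close> erases what is disjoint from
      \<open>f\<close>; this turns the local inequality into a global one.\<close>
    then have "f * npart ?z = 0"
      by (intro phi_disjoint_mult_0[OF phi]) (simp add: nonneg_on_def)
    then have "f * ?z = f * npart (- ?z)"
      by (metis ppart_minus_npart right_diff_distrib diff_zero)
    then have "0 \<le> f * ?z"
      using phi_mult_nonneg[OF phi, of f "npart (- ?z)"] f by (simp add: npart_nonneg)
    then show ?thesis by (simp add: algebra_simps)
  qed
  then show False
    using phi f unfolding phi_algebra_R_def archimedean_vl_def by (metis less_le)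
qed

text \<open>A nonzero negative part of \<open>y + \<epsilon>\<close> can serve as \<open>f\<close>.
  The piece \<open>f'\<close> found below it would be both disjoint from it and dominated by it,
  hence 0. The Archimedean property then removes \<open>\<epsilon>\<close>.\<close>

lemma nonneg_if_locally_nonneg:
  fixes y :: "'a::{ordered_real_vector,lattice,real_algebra,monoid_mult}"
  assumes phi: "phi_algebra_R TYPE('a)"
    and loc: "\<And>f \<epsilon>. 0 < f \<Longrightarrow> 0 < \<epsilon> \<Longrightarrow> \<exists>f'. 0 < f' \<and> f' \<le> f \<and> nonneg_on f' (y + \<epsilon> *\<^sub>R 1)"
  shows "0 \<le> y"
proof -
  have ge: "0 \<le> y + \<epsilon> *\<^sub>R 1" if "0 < \<epsilon>" for \<epsilon>
  proof (rule ccontr)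
    assume "\<not> 0 \<le> y + \<epsilon> *\<^sub>R 1"
    then have "0 < npart (y + \<epsilon> *\<^sub>R 1)"
      using npart_nonneg npart_eq_0_iff by (metis less_le)
    from loc[OF this that] show False
      by (auto simp: nonneg_on_def inf_absorb1)
  qed
  have "real m *\<^sub>R npart y \<le> 1" for m
  proof (cases "m = 0")
    case True
    then show ?thesis by (simp add: phi_one_nonneg[OF phi])
  next
    case False
    then have "npart y \<le> (1 / real m) *\<^sub>R 1"
      using add_right_mono[OF ge[of "1 / real m"], of "- y"] phi_one_nonneg[OF phi]
      unfolding npart_def by (intro sup_least) (auto simp: scaleR_nonneg_nonneg)
    then have "real m *\<^sub>R npart y \<le> real m *\<^sub>R ((1 / real m) *\<^sub>R 1)"
      by (intro scaleR_left_mono) auto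
    then show ?thesis using False by simp
  qed
  then have "npart y = 0"
    using phi npart_nonneg[of y] unfolding phi_algebra_R_def archimedean_vl_def by blast
  then show ?thesis by (simp add: npart_eq_0_iff)
qed

section \<open>Simultaneous local approximation by real constants\<close>

text \<open>Each condition passes to smaller positive elements and can be reached below every
  positive element, so finitely many are met by shrinking \<open>f\<close> successively.\<close>

lemma ex_below_conj:
  fixes Q :: "nat \<Rightarrow> 'a::{ordered_real_vector,lattice} \<Rightarrow> bool"
  assumes down: "\<And>k f f'. Q k f \<Longrightarrow> 0 < f' \<Longrightarrow> f' \<le> f \<Longrightarrow> Q k f'"
    and dense: "\<And>k f. k < n \<Longrightarrow> 0 < f \<Longrightarrow> \<exists>f'. 0 < f' \<and> f' \<le> f \<and> Q k f'"
    and f: "0 < f"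
  shows "\<exists>f'. 0 < f' \<and> f' \<le> f \<and> (\<forall>k<n. Q k f')"
  using dense
proof (induction n)
  case 0
  show ?case using f by auto
next
  case (Suc n)
  then obtain f1 where f1: "0 < f1" "f1 \<le> f" "\<forall>k<n. Q k f1"
    by (metis less_Suc_eq)
  obtain f2 where "0 < f2" "f2 \<le> f1" "Q n f2"
    using Suc.prems[of n f1] f1 by auto
  then show ?case
    using f1 by (intro exI[of _ f2]) (auto simp: less_Suc_eq intro: down)
qed

text \<open>Take the least \<open>j\<close> for which \<open>y\<close> is at most
  \<open>g (Suc j)\<close> on some \<open>f2\<close> below \<open>f\<close>. By minimality
  \<open>y\<close> is at most \<open>g j\<close> on no piece of \<open>f2\<close>, so the sign
  dichotomy gives the lower bound on all of \<open>f2\<close>. For \<open>j = 0\<close> that bound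
  is \<open>0 \<le> y\<close>.\<close>

lemma ex_grid_on:
  fixes f y :: "'a::{ordered_real_vector,lattice,real_algebra,monoid_mult}"
  assumes phi: "phi_algebra_R TYPE('a)" and f: "0 < f" and y: "0 \<le> y"
    and g0: "g 0 = 0" and g: "\<And>N. \<exists>j. real N \<le> g (Suc j)"
  shows "\<exists>f'. 0 < f' \<and> f' \<le> f \<and>
    (\<exists>j. nonneg_on f' (y - g j *\<^sub>R 1) \<and> nonneg_on f' (g (Suc j) *\<^sub>R 1 - y))"
proof -
  let ?P = "\<lambda>j. \<exists>f'. 0 < f' \<and> f' \<le> f \<and> nonneg_on f' (g (Suc j) *\<^sub>R 1 - y)"
  obtain f1 N where f1: "0 < f1" "f1 \<le> f" "nonneg_on f1 (real N *\<^sub>R 1 - y)"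
    using ex_bounded_on[OF phi f] by blast
  obtain j0 where "real N \<le> g (Suc j0)" using g by blast
  then have "real N *\<^sub>R 1 - y \<le> g (Suc j0) *\<^sub>R 1 - y"
    by (simp add: scaleR_right_mono phi_one_nonneg[OF phi])
  then have "?P j0"
    using f1 nonneg_on_mono by blast
  define j where "j = (LEAST j. ?P j)"
  have "?P j" unfolding j_def using \<open>?P j0\<close> by (rule LeastI)
  then obtain f2 where f2: "0 < f2" "f2 \<le> f" "nonneg_on f2 (g (Suc j) *\<^sub>R 1 - y)"
    by blast
  show ?thesis
  proof (cases j)
    case 0
    then have "nonneg_on f2 (y - g j *\<^sub>R 1)"
      using y f2 by (simp add: g0 nonneg_on_nonneg)
    then show ?thesis using f2 by blast
  next
    case (Suc i)
    then have "i < (LEAST j. ?P j)" by (simp add: j_def)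
    then have nP: "\<not> ?P i" by (rule not_less_Least)
    have "nonneg_on f2 (y - g j *\<^sub>R 1)"
    proof (rule nonneg_on_cases[OF f2(1), of "y - g j *\<^sub>R 1"])
      fix f' assume "0 < f'" "f' \<le> f2" "nonneg_on f' (- (y - g j *\<^sub>R 1))"
      then have "?P i"
        using f2(2) Suc by (intro exI[of _ f']) (auto intro: order_trans)
      then show ?thesis using nP by blast
    qed
    then show ?thesis using f2 by blast
  qed
qed

text \<open>The error depends on \<open>s\<close> only through the bound \<open>M\<close>. Hence
  \<open>\<epsilon>\<close> can be fixed before the grid values \<open>s k\<close> are
  known.\<close>

lemma prod_add_le:
  fixes s :: "nat \<Rightarrow> real"
  assumes "\<And>k. k < n \<Longrightarrow> 0 \<le> s k" "\<And>k. k < n \<Longrightarrow> s k + 1 \<le> M" "1 \<le> M" "0 \<le> \<epsilon>" "\<epsilon> \<le> 1"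
  shows "(\<Prod>k<n. s k + \<epsilon>) \<le> (\<Prod>k<n. s k) + \<epsilon> * real n * M ^ n"
  using assms(1,2)
proof (induction n)
  case (Suc n)
  let ?P = "\<Prod>k<n. s k"
  have s: "0 \<le> s n" "s n + 1 \<le> M" using Suc.prems by auto
  have "?P \<le> (\<Prod>k<n. M)"
    using Suc.prems by (intro prod_mono) (force simp: less_Suc_eq)
  also have "(\<Prod>k<n. M) \<le> M ^ Suc n" using assms(3) by simp
  finally have P: "?P \<le> M ^ Suc n" .
  have P0: "0 \<le> ?P" using Suc.prems by (intro prod_nonneg) auto
  have "(\<Prod>k<Suc n. s k + \<epsilon>) \<le> (?P + \<epsilon> * real n * M ^ n) * (s n + \<epsilon>)"
    using Suc s assms by (auto intro!: mult_right_mono)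
  also have "\<dots> = ?P * s n + \<epsilon> * ?P + \<epsilon> * real n * M ^ n * (s n + \<epsilon>)"
    by (simp add: algebra_simps)
  also have "\<dots> \<le> ?P * s n + \<epsilon> * M ^ Suc n + \<epsilon> * real n * M ^ n * M"
    using s assms(3-5) P P0 by (intro add_mono mult_left_mono) auto
  also have "\<dots> = (\<Prod>k<Suc n. s k) + \<epsilon> * real (Suc n) * M ^ Suc n"
    by (simp add: algebra_simps)
  finally show ?case .
qed simp

text \<open>Here \<open>s k\<close> approximates the power of \<open>c k\<close> with exponent
  \<open>r k\<close>, which is why the bounds on \<open>c k\<close> carry \<open>1 / r k\<close>.
  The choices are made in this order: local bounds \<open>N k\<close>, then \<open>M\<close>, then
  the mesh \<open>\<epsilon>\<close>, then the grid cells.\<close>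

lemma ex_local_values:
  fixes f :: "'a::{ordered_real_vector,lattice,real_algebra,monoid_mult}"
    and c :: "nat \<Rightarrow> 'a" and r :: "nat \<Rightarrow> real"
  assumes phi: "phi_algebra_R TYPE('a)" and f: "0 < f" and \<delta>: "0 < \<delta>"
    and c: "\<And>k. k < n \<Longrightarrow> 0 \<le> c k" and r: "\<And>k. k < n \<Longrightarrow> 0 < r k"
  obtains f' s \<epsilon> where "0 < f'" "f' \<le> f" "0 < \<epsilon>"
    "\<And>k. k < n \<Longrightarrow> 0 \<le> s k"
    "\<And>k. k < n \<Longrightarrow> nonneg_on f' (c k - (s k powr (1 / r k)) *\<^sub>R 1)"
    "\<And>k. k < n \<Longrightarrow> nonneg_on f' (((s k + \<epsilon>) powr (1 / r k)) *\<^sub>R 1 - c k)"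
    "(\<Prod>k<n. s k + \<epsilon>) \<le> (\<Prod>k<n. s k) + \<delta>"
proof -
  have "\<exists>f1. 0 < f1 \<and> f1 \<le> f \<and> (\<forall>k<n. \<exists>N. nonneg_on f1 (real N *\<^sub>R 1 - c k))"
  proof (rule ex_below_conj[where Q = "\<lambda>k f. \<exists>N. nonneg_on f (real N *\<^sub>R 1 - c k)", OF _ _ f])
    show "\<exists>f'. 0 < f' \<and> f' \<le> f \<and> (\<exists>N. nonneg_on f' (real N *\<^sub>R 1 - c k))" if "0 < f" for k f
      using ex_bounded_on[OF phi that] by blast
  qed (meson nonneg_on_subset less_imp_le)
  then obtain f1 N where f1: "0 < f1" "f1 \<le> f"
    and N: "\<And>k. k < n \<Longrightarrow> nonneg_on f1 (real (N k) *\<^sub>R 1 - c k)"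
    by metis
  define M where "M = 1 + (\<Sum>k<n. real (N k) powr r k)"
  have M: "1 \<le> M" by (simp add: M_def sum_nonneg)
  \<comment> \<open>The summand 1 keeps the denominator positive also for \<open>n = 0\<close>; the
    cap at 1 is what \<open>prod_add_le\<close> asks for.\<close>
  define \<epsilon> where "\<epsilon> = min 1 (\<delta> / (real n * M ^ n + 1))"
  have pos: "0 < real n * M ^ n + 1"
    using M by (intro add_nonneg_pos) auto
  have \<epsilon>: "0 < \<epsilon>" "\<epsilon> \<le> 1" using pos \<delta> by (auto simp: \<epsilon>_def)
  have "\<epsilon> * (real n * M ^ n) \<le> \<epsilon> * (real n * M ^ n + 1)"
    using \<epsilon> by simp
  also have "\<epsilon> \<le> \<delta> / (real n * M ^ n + 1)"
    by (simp add: \<epsilon>_def)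
  then have "\<epsilon> * (real n * M ^ n + 1) \<le> \<delta>"
    using pos by (simp add: pos_le_divide_eq)
  finally have \<epsilon>\<delta>: "\<epsilon> * real n * M ^ n \<le> \<delta>" by (simp add: mult.assoc)
  \<comment> \<open>The grid for \<open>c k\<close> becomes equidistant with mesh
    \<open>\<epsilon>\<close> after raising to the power \<open>r k\<close>.\<close>
  let ?g = "\<lambda>k j. (real j * \<epsilon>) powr (1 / r k)"
  have "\<exists>f2. 0 < f2 \<and> f2 \<le> f1 \<and>
    (\<forall>k<n. \<exists>j. nonneg_on f2 (c k - ?g k j *\<^sub>R 1) \<and> nonneg_on f2 (?g k (Suc j) *\<^sub>R 1 - c k))"
  proof (rule ex_below_conj[where Q = "\<lambda>k f. \<exists>j. nonneg_on f (c k - ?g k j *\<^sub>R 1) \<and>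
        nonneg_on f (?g k (Suc j) *\<^sub>R 1 - c k)", OF _ _ f1(1)])
    fix k f assume k: "k < n" and f: "0 < (f::'a)"
    show "\<exists>f'. 0 < f' \<and> f' \<le> f \<and>
      (\<exists>j. nonneg_on f' (c k - ?g k j *\<^sub>R 1) \<and> nonneg_on f' (?g k (Suc j) *\<^sub>R 1 - c k))"
    proof (rule ex_grid_on[OF phi f c[OF k]])
      show "\<exists>j. real N \<le> ?g k (Suc j)" for N
      proof -
        obtain j where "real N powr r k / \<epsilon> \<le> real j" using real_arch_simple by blast
        then have "real N powr r k \<le> real (Suc j) * \<epsilon>"
          using \<epsilon> by (auto simp: field_simps intro: order_trans)
        then have "(real N powr r k) powr (1 / r k) \<le> ?g k (Suc j)"
          using r[OF k] by (intro powr_mono2) auto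
        then show ?thesis using r[OF k] by (auto simp: powr_powr)
      qed
    qed simp
  qed (meson nonneg_on_subset less_imp_le)
  then obtain f2 j where f2: "0 < f2" "f2 \<le> f1"
    and j: "\<And>k. k < n \<Longrightarrow> nonneg_on f2 (c k - ?g k (j k) *\<^sub>R 1)"
      "\<And>k. k < n \<Longrightarrow> nonneg_on f2 (?g k (Suc (j k)) *\<^sub>R 1 - c k)"
    by metis
  define s where "s k = real (j k) * \<epsilon>" for k
  have s0: "0 \<le> s k" for k using \<epsilon> by (simp add: s_def)
  \<comment> \<open>On \<open>f2\<close> the element \<open>c k\<close> is at least
    \<open>s k powr (1 / r k)\<close> and at most \<open>N k\<close>, so these two constants compare
    as reals.\<close>
  have sM: "s k + 1 \<le> M" if k: "k < n" for k
  proof -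
    have "nonneg_on f2 ((real (N k) *\<^sub>R 1 - c k) + (c k - s k powr (1 / r k) *\<^sub>R 1))"
      using j(1)[OF k] N[OF k] f2 unfolding s_def
      by (intro nonneg_on_add) (auto intro: nonneg_on_subset)
    then have "nonneg_on f2 ((real (N k) - s k powr (1 / r k)) *\<^sub>R 1)"
      by (simp add: algebra_simps)
    then have "s k powr (1 / r k) \<le> real (N k)"
      using nonneg_on_const[OF phi f2(1)] by force
    then have "(s k powr (1 / r k)) powr r k \<le> real (N k) powr r k"
      using r[OF k] by (intro powr_mono2) auto
    then have "s k \<le> real (N k) powr r k"
      using r[OF k] s0[of k] by (simp add: powr_powr)
    also have "\<dots> \<le> (\<Sum>k<n. real (N k) powr r k)"
      using k by (intro member_le_sum) auto
    finally show ?thesis by (simp add: M_def)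
  qed
  show ?thesis
  proof (rule that[of f2 \<epsilon> s])
    show "f2 \<le> f" using f1 f2 by (blast intro: order_trans)
    show "(\<Prod>k<n. s k + \<epsilon>) \<le> (\<Prod>k<n. s k) + \<delta>"
      using prod_add_le[of n s M \<epsilon>] s0 sM M \<epsilon> \<epsilon>\<delta> by fastforce
  qed (use f2 \<epsilon> s0 j in \<open>auto simp: s_def algebra_simps\<close>)
qed

section \<open>Comparing products, powers and weighted means\<close>

text \<open>If some \<open>x k\<close> is 0, so is the left side. Otherwise apply ln u \<le> u - 1
  to u = \<open>x k / ?G\<close> and add with weights \<open>r k\<close>; the logarithms
  cancel.\<close>

lemma weighted_geometric_le_arithmetic:
  fixes x r :: "nat \<Rightarrow> real"
  assumes x: "\<And>k. k < n \<Longrightarrow> 0 \<le> x k" and r: "\<And>k. k < n \<Longrightarrow> 0 < r k" and r1: "(\<Sum>k<n. r k) = 1"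
  shows "(\<Prod>k<n. x k powr r k) \<le> (\<Sum>k<n. r k * x k)"
proof (cases "\<exists>k<n. x k = 0")
  case True
  then have "(\<Prod>k<n. x k powr r k) = 0" by auto
  moreover have "0 \<le> (\<Sum>k<n. r k * x k)"
    using x r by (auto intro!: sum_nonneg simp: less_imp_le)
  ultimately show ?thesis by linarith
next
  case False
  then have x: "\<And>k. k < n \<Longrightarrow> 0 < x k" using x by (metis less_le)
  then have nz: "\<And>k. k < n \<Longrightarrow> x k \<noteq> 0" by (metis less_irrefl)
  let ?G = "\<Prod>k<n. x k powr r k"
  have G: "0 < ?G" using x by (intro prod_pos) (auto simp: nz)
  have "ln ?G = (\<Sum>k<n. r k * ln (x k))"
    by (subst ln_prod) (auto simp: ln_powr nz)
  then have "1 = (\<Sum>k<n. r k * (1 + (ln (x k) - ln ?G)))"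
    using r1 by (simp add: algebra_simps sum.distrib sum_subtractf flip: sum_distrib_right)
  also have "\<dots> \<le> (\<Sum>k<n. r k * (x k / ?G))"
  proof (intro sum_mono mult_left_mono)
    fix k assume "k \<in> {..<n}"
    then show "1 + (ln (x k) - ln ?G) \<le> x k / ?G" "0 \<le> r k"
      using x[of k] r[of k] G ln_le_minus_one[of "x k / ?G"] ln_divide_pos[of "x k" ?G]
      by (simp_all del: ln_prod)
  qed
  also have "\<dots> = (\<Sum>k<n. r k * x k) / ?G"
    by (simp add: sum_divide_distrib)
  finally show ?thesis using G by (simp add: field_simps)
qed

section \<open>Infima, absolute values and real powers\<close>

lemma vl_is_inf_unique: "vl_is_inf S x \<Longrightarrow> vl_is_inf S y \<Longrightarrow> x = y"
  unfolding vl_is_inf_def by (intro antisym) auto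

lemma vl_Inf_eqI: "vl_is_inf S x \<Longrightarrow> vl_Inf S = x"
  unfolding vl_Inf_def by (blast intro: vl_is_inf_unique)

lemma vl_abs_of_nonneg: "0 \<le> x \<Longrightarrow> vl_abs x = (x::'a::{ordered_real_vector,lattice})"
  unfolding vl_abs_def by (rule sup_absorb1) (metis neg_le_0_iff_le order_trans)

lemma vl_abs_nonneg: "0 \<le> vl_abs (x::'a::{ordered_real_vector,lattice})"
proof -
  have "x + - x \<le> vl_abs x + vl_abs x"
    unfolding vl_abs_def by (intro add_mono) auto
  then have "(1/2) *\<^sub>R 0 \<le> (1/2) *\<^sub>R (2 *\<^sub>R vl_abs x)"
    by (intro scaleR_left_mono) (auto simp: scaleR_2)
  then show ?thesis by simp
qed

lemma vl_abs_eq_iff: "vl_abs x = x \<longleftrightarrow> 0 \<le> x"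
  using vl_abs_nonneg[of x] vl_abs_of_nonneg[of x] by auto

text \<open>The set whose infimum is the fractional factor in \<open>vl_pow\<close>. For
  \<open>0 \<le> b\<close> and \<open>s\<close> in (0,1) it is the weighted mean set of
  \<open>b\<close> and 1 with weights \<open>s\<close> and \<open>1 - s\<close>.\<close>

definition root_set :: "'a::{ordered_real_vector,lattice,real_algebra,monoid_mult} \<Rightarrow> real \<Rightarrow> 'a set" where
  "root_set b s = {(s * \<theta>1) *\<^sub>R b + ((1 - s) * \<theta>2) *\<^sub>R 1 | \<theta>1 \<theta>2.
     0 < \<theta>1 \<and> 0 < \<theta>2 \<and> \<theta>1 powr s * \<theta>2 powr (1 - s) = 1}"

lemma ex_inf_root_set:
  fixes b :: "'a::{ordered_real_vector,lattice,real_algebra,monoid_mult}"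
  assumes phi: "phi_algebra_R TYPE('a)" and wgm: "wgm_closed_R TYPE('a)"
    and b: "0 \<le> b" and s: "0 < s" "s < 1"
  shows "\<exists>g. vl_is_inf (root_set b s) g"
proof -
  let ?f = "\<lambda>k::nat. if k = 0 then b else 1" and ?r = "\<lambda>k::nat. if k = 0 then s else 1 - s"
  have "wgm_set_R 2 ?f ?r = root_set b s"
  proof (intro subset_antisym subsetI)
    fix x assume "x \<in> wgm_set_R 2 ?f ?r"
    then obtain \<theta> where "x = (\<Sum>k<2. (?r k * \<theta> k) *\<^sub>R vl_abs (?f k))" "\<forall>k<2. 0 < \<theta> k"
      "(\<Prod>k<2. \<theta> k powr ?r k) = 1"
      unfolding wgm_set_R_def by blast
    then show "x \<in> root_set b s"
      unfolding root_set_def using b phi_one_nonneg[OF phi]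
      by (intro CollectI exI[of _ "\<theta> 0"] exI[of _ "\<theta> 1"])
        (auto simp: numeral_2_eq_2 vl_abs_of_nonneg)
  next
    fix x assume "x \<in> root_set b s"
    then obtain \<theta>1 \<theta>2 where "x = (s * \<theta>1) *\<^sub>R b + ((1 - s) * \<theta>2) *\<^sub>R 1" "0 < \<theta>1" "0 < \<theta>2"
      "\<theta>1 powr s * \<theta>2 powr (1 - s) = 1"
      unfolding root_set_def by blast
    then show "x \<in> wgm_set_R 2 ?f ?r"
      unfolding wgm_set_R_def using b phi_one_nonneg[OF phi]
      by (intro CollectI exI[of _ "\<lambda>k. if k = 0 then \<theta>1 else \<theta>2"])
        (auto simp: numeral_2_eq_2 vl_abs_of_nonneg)
  qed
  moreover have "\<exists>x. vl_is_inf (wgm_set_R 2 ?f ?r) x"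
    using wgm[unfolded wgm_closed_R_def, rule_format, of 2 ?r ?f] s by (auto simp: numeral_2_eq_2)
  ultimately show ?thesis by simp
qed

lemma vl_pow_eq:
  assumes "vl_is_inf (root_set b (frac r)) g" "frac r \<noteq> 0"
  shows "vl_pow b r = b ^ nat \<lfloor>r\<rfloor> * g"
  using vl_Inf_eqI[OF assms(1)] assms(2) by (simp add: vl_pow_def root_set_def)

lemma root_set_nonneg:
  fixes b :: "'a::{ordered_real_vector,lattice,real_algebra,monoid_mult}"
  assumes "phi_algebra_R TYPE('a)" "0 \<le> b" "0 < s" "s < 1" "x \<in> root_set b s"
  shows "0 \<le> x"
  using assms phi_one_nonneg[OF assms(1)] unfolding root_set_def
  by (auto intro!: add_nonneg_nonneg scaleR_nonneg_nonneg)

lemma vl_pow_nonneg: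
  fixes b :: "'a::{ordered_real_vector,lattice,real_algebra,monoid_mult}"
  assumes phi: "phi_algebra_R TYPE('a)" and wgm: "wgm_closed_R TYPE('a)" and b: "0 \<le> b"
  shows "0 \<le> vl_pow b r"
proof (cases "frac r = 0")
  case True
  then show ?thesis by (simp add: vl_pow_def phi_power_nonneg[OF phi b])
next
  case False
  then have s: "0 < frac r" "frac r < 1"
    using frac_ge_0[of r] frac_lt_1[of r] by linarith+
  obtain g where g: "vl_is_inf (root_set b (frac r)) g"
    using ex_inf_root_set[OF phi wgm b s] by blast
  then have "0 \<le> g"
    using root_set_nonneg[OF phi b s] unfolding vl_is_inf_def by blast
  then show ?thesis
    using vl_pow_eq[OF g False] phi_mult_nonneg[OF phi phi_power_nonneg[OF phi b]] by simp
qed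

text \<open>As \<open>g\<close> is determined by global lower bounds, the local bound on
  \<open>b\<close> has to be turned into a global minorant of \<open>root_set b s\<close>.\<close>

lemma nonneg_on_inf_root_set:
  fixes b :: "'a::{ordered_real_vector,lattice,real_algebra,monoid_mult}"
  assumes phi: "phi_algebra_R TYPE('a)" and b: "0 \<le> b" and t: "0 < t" and s: "0 < s" "s < 1"
    and g: "vl_is_inf (root_set b s) g" and bt: "nonneg_on f (b - t *\<^sub>R 1)"
  shows "nonneg_on f (g - (t powr s) *\<^sub>R 1)"
proof -
  note one = phi_one_nonneg[OF phi]
  let ?w = "inf (b - t *\<^sub>R 1) 0"
  let ?z = "1 + (1 / t) *\<^sub>R ?w"
  \<comment> \<open>A minorant \<open>t\<^sup>s min(1, b / t)\<close> of \<open>b\<^sup>s\<close>, equal to \<open>t\<^sup>s\<close> where \<open>b \<ge> t\<close>.\<close>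
  have "- (t *\<^sub>R 1) \<le> ?w" using b t one by (simp add: scaleR_nonneg_nonneg)
  then have "(1 / t) *\<^sub>R (- (t *\<^sub>R 1)) \<le> (1 / t) *\<^sub>R ?w"
    using t by (intro scaleR_left_mono) auto
  then have z: "0 \<le> ?z"
    using t add_left_mono[of "- 1" "(1 / t) *\<^sub>R ?w" 1] by simp
  have z1: "?z \<le> 1"
    using t by (auto intro: scaleR_nonneg_nonpos)
  have tz: "t *\<^sub>R ?z \<le> b"
  proof -
    have "t *\<^sub>R ?z = t *\<^sub>R 1 + ?w" using t by (simp add: scaleR_add_right)
    also have "\<dots> \<le> t *\<^sub>R 1 + (b - t *\<^sub>R 1)" by (intro add_left_mono) simp
    finally show ?thesis by simp
  qed
  have lower: "(t powr s) *\<^sub>R ?z \<le> x" if x_in: "x \<in> root_set b s" for x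
  proof -
    obtain \<theta>1 \<theta>2 where x: "x = (s * \<theta>1) *\<^sub>R b + ((1 - s) * \<theta>2) *\<^sub>R 1" "0 < \<theta>1" "0 < \<theta>2"
      "\<theta>1 powr s * \<theta>2 powr (1 - s) = 1"
      using x_in unfolding root_set_def by blast
    \<comment> \<open>Real weighted AM-GM for the two numbers \<open>\<theta>1 * t\<close> and
      \<open>\<theta>2\<close>.\<close>
    have "t powr s = (\<theta>1 * t) powr s * \<theta>2 powr (1 - s)"
      using x t by (simp add: powr_mult)
    also have "\<dots> \<le> s * (\<theta>1 * t) + (1 - s) * \<theta>2"
      using weighted_geometric_le_arithmetic[of 2 "\<lambda>k. if k = 0 then \<theta>1 * t else \<theta>2"
          "\<lambda>k. if k = 0 then s else 1 - s"] x t s by (simp add: numeral_2_eq_2)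
    finally have "(t powr s) *\<^sub>R ?z \<le> (s * (\<theta>1 * t) + (1 - s) * \<theta>2) *\<^sub>R ?z"
      using z by (intro scaleR_right_mono)
    also have "\<dots> = (s * \<theta>1) *\<^sub>R (t *\<^sub>R ?z) + ((1 - s) * \<theta>2) *\<^sub>R ?z"
      by (simp add: scaleR_add_left mult.assoc)
    also have "\<dots> \<le> x"
      unfolding x(1) using x s tz z1 by (intro add_mono scaleR_left_mono) auto
    finally show ?thesis .
  qed
  have "(t powr s) *\<^sub>R ?z \<le> g"
    using g lower unfolding vl_is_inf_def by blast
  then have "(t powr s / t) *\<^sub>R ?w \<le> g - (t powr s) *\<^sub>R 1"
    by (simp add: scaleR_add_right algebra_simps)
  moreover have "nonneg_on f ((t powr s / t) *\<^sub>R ?w)"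
    using t by (intro nonneg_on_scaleR nonneg_on_inf_0 bt) auto
  ultimately show ?thesis by (blast intro: nonneg_on_mono)
qed

text \<open>Write yz - uv = (y - u) z + u (z - v); both summands are nonnegative on
  \<open>f\<close>.\<close>

lemma nonneg_on_mult_diff:
  fixes y z :: "'a::{ordered_real_vector,lattice,real_algebra,monoid_mult}"
  assumes phi: "phi_algebra_R TYPE('a)" and "nonneg_on f (y - u *\<^sub>R 1)" "nonneg_on f (z - v *\<^sub>R 1)"
    and "0 \<le> u" "0 \<le> z"
  shows "nonneg_on f (y * z - (u * v) *\<^sub>R 1)"
proof -
  have "nonneg_on f ((y - u *\<^sub>R 1) * z + u *\<^sub>R (z - v *\<^sub>R 1))"
    using assms by (intro nonneg_on_add nonneg_on_mult(1) nonneg_on_scaleR) auto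
  then show ?thesis by (simp add: algebra_simps)
qed

lemma nonneg_on_diff_mult:
  fixes y z :: "'a::{ordered_real_vector,lattice,real_algebra,monoid_mult}"
  assumes phi: "phi_algebra_R TYPE('a)" and "nonneg_on f (u *\<^sub>R 1 - y)" "nonneg_on f (v *\<^sub>R 1 - z)"
    and "0 \<le> u" "0 \<le> z"
  shows "nonneg_on f ((u * v) *\<^sub>R 1 - y * z)"
proof -
  have "nonneg_on f ((u *\<^sub>R 1 - y) * z + u *\<^sub>R (v *\<^sub>R 1 - z))"
    using assms by (intro nonneg_on_add nonneg_on_mult(1) nonneg_on_scaleR) auto
  then show ?thesis by (simp add: algebra_simps)
qed

lemma nonneg_on_power_diff:
  fixes b :: "'a::{ordered_real_vector,lattice,real_algebra,monoid_mult}"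
  assumes phi: "phi_algebra_R TYPE('a)" and bt: "nonneg_on f (b - t *\<^sub>R 1)" and "0 \<le> b" "0 \<le> t"
  shows "nonneg_on f (b ^ m - (t ^ m) *\<^sub>R 1)"
proof (induction m)
  case 0
  then show ?case by (simp add: nonneg_on_nonneg nonneg_on_base[OF bt])
next
  case (Suc m)
  then show ?case
    using nonneg_on_mult_diff[OF phi bt Suc.IH] assms by (simp add: phi_power_nonneg)
qed

text \<open>The exponent splits into integer and fractional part. Lower bounds suffice for what
  follows, because powers stand on the larger side of both comparison inequalities.\<close>

lemma nonneg_on_vl_pow_diff:
  fixes b :: "'a::{ordered_real_vector,lattice,real_algebra,monoid_mult}"
  assumes phi: "phi_algebra_R TYPE('a)" and wgm: "wgm_closed_R TYPE('a)"
    and b: "0 \<le> b" and t: "0 \<le> t" and r: "0 < r" and bt: "nonneg_on f (b - t *\<^sub>R 1)"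
  shows "nonneg_on f (vl_pow b r - (t powr r) *\<^sub>R 1)"
proof (cases "t = 0")
  case True
  then show ?thesis
    using vl_pow_nonneg[OF phi wgm b] by (simp add: nonneg_on_nonneg nonneg_on_base[OF bt])
next
  case False
  with t have t: "0 < t" by simp
  let ?m = "nat \<lfloor>r\<rfloor>" and ?s = "frac r"
  have pow: "nonneg_on f (b ^ ?m - (t ^ ?m) *\<^sub>R 1)"
    using nonneg_on_power_diff[OF phi bt b] t by simp
  have r_eq: "r = real ?m + ?s" using r by (simp add: frac_def)
  have tr: "t powr r = t ^ ?m * t powr ?s"
    by (subst r_eq) (use t in \<open>simp add: powr_add powr_realpow\<close>)
  show ?thesis
  proof (cases "?s = 0")
    case True
    have "t powr ?s = 1" unfolding True using t by simp
    then show ?thesis using pow tr True by (simp add: vl_pow_def)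
  next
    case False
    then have s: "0 < ?s" "?s < 1"
      using frac_ge_0[of r] frac_lt_1[of r] by linarith+
    obtain g where g: "vl_is_inf (root_set b ?s) g"
      using ex_inf_root_set[OF phi wgm b s] by blast
    then have "0 \<le> g"
      using root_set_nonneg[OF phi b s] unfolding vl_is_inf_def by blast
    then show ?thesis
      unfolding vl_pow_eq[OF g False] tr
      using nonneg_on_inf_root_set[OF phi b t s g bt] pow t
      by (intro nonneg_on_mult_diff[OF phi]) auto
  qed
qed

lemma nonneg_on_prod_list_diff:
  fixes y :: "nat \<Rightarrow> 'a::{ordered_real_vector,lattice,real_algebra,monoid_mult}"
  assumes phi: "phi_algebra_R TYPE('a)" and f: "0 \<le> f"
    and "\<And>k. k < n \<Longrightarrow> 0 \<le> y k" "\<And>k. k < n \<Longrightarrow> 0 \<le> u k"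
      "\<And>k. k < n \<Longrightarrow> nonneg_on f (y k - u k *\<^sub>R 1)"
  shows "nonneg_on f (prod_list (map y [0..<n]) - (\<Prod>k<n. u k) *\<^sub>R 1)"
  using assms(3-)
proof (induction n)
  case (Suc n)
  have "0 \<le> (\<Prod>k<n. u k)"
    using Suc.prems by (intro prod_nonneg) auto
  then show ?case
    using nonneg_on_mult_diff[OF phi Suc.IH Suc.prems(3)[of n]] Suc.prems by simp
qed (simp add: nonneg_on_nonneg f)

lemma nonneg_on_diff_prod_list:
  fixes y :: "nat \<Rightarrow> 'a::{ordered_real_vector,lattice,real_algebra,monoid_mult}"
  assumes phi: "phi_algebra_R TYPE('a)" and f: "0 \<le> f"
    and "\<And>k. k < n \<Longrightarrow> 0 \<le> y k" "\<And>k. k < n \<Longrightarrow> 0 \<le> u k"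
      "\<And>k. k < n \<Longrightarrow> nonneg_on f (u k *\<^sub>R 1 - y k)"
  shows "nonneg_on f ((\<Prod>k<n. u k) *\<^sub>R 1 - prod_list (map y [0..<n]))"
  using assms(3-)
proof (induction n)
  case (Suc n)
  have "0 \<le> (\<Prod>k<n. u k)"
    using Suc.prems by (intro prod_nonneg) auto
  then show ?case
    using nonneg_on_diff_mult[OF phi Suc.IH Suc.prems(3)[of n]] Suc.prems by simp
qed (simp add: nonneg_on_nonneg f)

section \<open>The two comparison inequalities\<close>

text \<open>On a small \<open>f'\<close> each \<open>b k\<close> lies between \<open>s k\<close> and
  \<open>s k + \<epsilon>\<close>. The product is then at most that of the \<open>s k\<close> plus
  \<open>\<delta>\<close>, the powers are at least \<open>s k powr p k\<close>, and real AM-GM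
  connects the two.\<close>

lemma prod_le_weighted_sum_vl_pow:
  fixes b :: "nat \<Rightarrow> 'a::{ordered_real_vector,lattice,real_algebra,monoid_mult}"
  assumes phi: "phi_algebra_R TYPE('a)" and wgm: "wgm_closed_R TYPE('a)"
    and b: "\<And>k. k < n \<Longrightarrow> 0 \<le> b k" and p: "\<And>k. k < n \<Longrightarrow> 0 < p k" and p1: "(\<Sum>k<n. 1 / p k) = 1"
    and \<theta>: "\<And>k. k < n \<Longrightarrow> 0 < \<theta> k" and \<theta>1: "(\<Prod>k<n. \<theta> k powr (1 / p k)) = 1"
  shows "prod_list (map b [0..<n]) \<le> (\<Sum>k<n. (1 / p k * \<theta> k) *\<^sub>R vl_pow (b k) (p k))"
    (is "?L \<le> ?R")
proof -
  have "\<exists>f'. 0 < f' \<and> f' \<le> f \<and> nonneg_on f' (?R - ?L + \<delta> *\<^sub>R 1)"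
    if f: "0 < f" and \<delta>: "0 < \<delta>" for f and \<delta> :: real
  proof -
    obtain f' s \<epsilon> where f': "0 < f'" "f' \<le> f" and \<epsilon>: "0 < \<epsilon>" and s: "\<And>k. k < n \<Longrightarrow> 0 \<le> s k"
      and lower: "\<And>k. k < n \<Longrightarrow> nonneg_on f' (b k - (s k powr (1 / 1)) *\<^sub>R 1)"
      and upper: "\<And>k. k < n \<Longrightarrow> nonneg_on f' (((s k + \<epsilon>) powr (1 / 1)) *\<^sub>R 1 - b k)"
      and prod: "(\<Prod>k<n. s k + \<epsilon>) \<le> (\<Prod>k<n. s k) + \<delta>"
      \<comment> \<open>Exponent 1, because here the \<open>b k\<close> themselves are
        approximated.\<close>
      using ex_local_values[OF phi f \<delta>, of n b "\<lambda>_. 1"] b zero_less_one by metis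
    have lower: "nonneg_on f' (b k - s k *\<^sub>R 1)" if "k < n" for k
      using lower[OF that] s[OF that] by simp
    have upper: "nonneg_on f' ((s k + \<epsilon>) *\<^sub>R 1 - b k)" if "k < n" for k
      using upper[OF that] s[OF that] \<epsilon> by simp
    let ?S = "\<Sum>k<n. 1 / p k * (\<theta> k * s k powr p k)"
    \<comment> \<open>The factor inserted is 1; it puts the product into the form required by
      AM-GM.\<close>
    have "(\<Prod>k<n. s k) = (\<Prod>k<n. \<theta> k powr (1 / p k)) * (\<Prod>k<n. s k)"
      by (simp only: \<theta>1 mult_1_left)
    also have "\<dots> = (\<Prod>k<n. (\<theta> k * s k powr p k) powr (1 / p k))"
      unfolding prod.distrib[symmetric]
    proof (intro prod.cong refl)
      fix k assume "k \<in> {..<n}"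
      then show "\<theta> k powr (1 / p k) * s k = (\<theta> k * s k powr p k) powr (1 / p k)"
        using \<theta>[of k] s[of k] p[of k] by (simp add: powr_mult powr_powr)
    qed
    also have "\<dots> \<le> ?S"
      using \<theta> s p p1 by (intro weighted_geometric_le_arithmetic) (auto simp: less_imp_le)
    finally have "(\<Prod>k<n. s k + \<epsilon>) \<le> ?S + \<delta>" using prod by simp
    then have "nonneg_on f' ((?S + \<delta> - (\<Prod>k<n. s k + \<epsilon>)) *\<^sub>R 1)"
      using f' phi_one_nonneg[OF phi] by (intro nonneg_on_nonneg scaleR_nonneg_nonneg) auto
    moreover have "nonneg_on f' ((\<Prod>k<n. s k + \<epsilon>) *\<^sub>R 1 - ?L)"
      using b s \<epsilon> f' upper by (intro nonneg_on_diff_prod_list[OF phi]) (auto simp: less_imp_le)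
    moreover have "nonneg_on f'
        (\<Sum>k<n. (1 / p k * \<theta> k) *\<^sub>R (vl_pow (b k) (p k) - (s k powr p k) *\<^sub>R 1))"
      using f' p \<theta> b s lower
      by (intro nonneg_on_sum nonneg_on_scaleR nonneg_on_vl_pow_diff[OF phi wgm])
        (auto simp: less_imp_le)
    ultimately have "nonneg_on f' ((?S + \<delta> - (\<Prod>k<n. s k + \<epsilon>)) *\<^sub>R 1 + ((\<Prod>k<n. s k + \<epsilon>) *\<^sub>R 1 - ?L)
        + (\<Sum>k<n. (1 / p k * \<theta> k) *\<^sub>R (vl_pow (b k) (p k) - (s k powr p k) *\<^sub>R 1)))"
      by (intro nonneg_on_add)
    also have "(\<Sum>k<n. (1 / p k * \<theta> k) *\<^sub>R (vl_pow (b k) (p k) - (s k powr p k) *\<^sub>R 1)) = ?R - ?S *\<^sub>R 1"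
      by (simp add: scaleR_diff_right sum_subtractf scaleR_sum_left)
    finally have "nonneg_on f' (?R - ?L + \<delta> *\<^sub>R 1)"
      by (simp add: algebra_simps)
    then show ?thesis using f' by blast
  qed
  then have "0 \<le> ?R - ?L" by (rule nonneg_if_locally_nonneg[OF phi])
  then show ?thesis by simp
qed

text \<open>The bound on \<open>x\<close> is assumed for all \<open>\<theta>\<close> because the
  near-optimal one depends on the piece \<open>f'\<close>. With it \<open>x\<close> is at most
  \<open>G\<close> on \<open>f'\<close>, and \<open>G\<close> exceeds the product of the
  \<open>s k\<close> by at most \<open>\<delta>\<close>.\<close>

lemma weighted_inf_le_prod_vl_pow:
  fixes c :: "nat \<Rightarrow> 'a::{ordered_real_vector,lattice,real_algebra,monoid_mult}"
  assumes phi: "phi_algebra_R TYPE('a)" and wgm: "wgm_closed_R TYPE('a)"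
    and c: "\<And>k. k < n \<Longrightarrow> 0 \<le> c k" and r: "\<And>k. k < n \<Longrightarrow> 0 < r k" and r1: "(\<Sum>k<n. r k) = 1"
    and x: "\<And>\<theta>. (\<And>k. k < n \<Longrightarrow> 0 < \<theta> k) \<Longrightarrow> (\<Prod>k<n. \<theta> k powr r k) = 1 \<Longrightarrow>
      x \<le> (\<Sum>k<n. (r k * \<theta> k) *\<^sub>R c k)"
  shows "x \<le> prod_list (map (\<lambda>k. vl_pow (c k) (r k)) [0..<n])" (is "_ \<le> ?R")
proof -
  have "\<exists>f'. 0 < f' \<and> f' \<le> f \<and> nonneg_on f' (?R - x + \<delta> *\<^sub>R 1)"
    if f: "0 < f" and \<delta>: "0 < \<delta>" for f and \<delta> :: real
  proof -
    obtain f' s \<epsilon> where f': "0 < f'" "f' \<le> f" and \<epsilon>: "0 < \<epsilon>" and s: "\<And>k. k < n \<Longrightarrow> 0 \<le> s k"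
      and lower: "\<And>k. k < n \<Longrightarrow> nonneg_on f' (c k - (s k powr (1 / r k)) *\<^sub>R 1)"
      and upper: "\<And>k. k < n \<Longrightarrow> nonneg_on f' (((s k + \<epsilon>) powr (1 / r k)) *\<^sub>R 1 - c k)"
      and prod: "(\<Prod>k<n. s k + \<epsilon>) \<le> (\<Prod>k<n. s k) + \<delta>"
      using ex_local_values[OF phi f \<delta>, of n c r] c r by metis
    define G where "G = (\<Prod>k<n. s k + \<epsilon>)"
    have G: "0 < G" unfolding G_def using s \<epsilon> by (intro prod_pos) (auto intro: add_nonneg_pos)
    \<comment> \<open>Equality case of the weighted AM-GM inequality for the upper bounds of the \<open>c k\<close>.\<close>
    define \<theta> where "\<theta> k = G / (s k + \<epsilon>) powr (1 / r k)" for k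
    have s\<epsilon>: "0 < s k + \<epsilon>" if "k < n" for k using s[OF that] \<epsilon> by simp
    have \<theta>: "0 < \<theta> k" if "k < n" for k
      using G s\<epsilon>[OF that] by (simp add: \<theta>_def)
    have "(\<Prod>k<n. \<theta> k powr r k) = (\<Prod>k<n. G powr r k / (s k + \<epsilon>))"
    proof (intro prod.cong refl)
      fix k assume "k \<in> {..<n}"
      then show "\<theta> k powr r k = G powr r k / (s k + \<epsilon>)"
        using s\<epsilon>[of k] r[of k] G by (simp add: \<theta>_def powr_divide powr_powr)
    qed
    also have "\<dots> = 1"
      using G r1 by (simp add: prod_dividef G_def[symmetric] flip: powr_sum)
    finally have "x \<le> (\<Sum>k<n. (r k * \<theta> k) *\<^sub>R c k)"
      using \<theta> by (intro x)
    then have 1: "nonneg_on f' ((\<Sum>k<n. (r k * \<theta> k) *\<^sub>R c k) - x)"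
      using f' by (intro nonneg_on_nonneg) auto
    have 2: "nonneg_on f' (\<Sum>k<n. (r k * \<theta> k) *\<^sub>R (((s k + \<epsilon>) powr (1 / r k)) *\<^sub>R 1 - c k))"
      using f' r \<theta> upper by (intro nonneg_on_sum nonneg_on_scaleR) (auto simp: less_imp_le)
    \<comment> \<open>By the choice of \<open>\<theta>\<close> every term has the same value
      \<open>G\<close> apart from its weight.\<close>
    have "(\<Sum>k<n. (r k * \<theta> k) *\<^sub>R (((s k + \<epsilon>) powr (1 / r k)) *\<^sub>R (1::'a))) = (\<Sum>k<n. (r k * G) *\<^sub>R 1)"
      using s\<epsilon> by (intro sum.cong refl) (force simp: \<theta>_def)
    also have "\<dots> = G *\<^sub>R 1"
      using r1 by (simp flip: scaleR_sum_left sum_distrib_right)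
    finally have "nonneg_on f' (G *\<^sub>R 1 - x)"
      using nonneg_on_add[OF 1 2] by (simp add: scaleR_diff_right sum_subtractf)
    moreover have "nonneg_on f' (?R - (\<Prod>k<n. s k) *\<^sub>R 1)"
    proof (rule nonneg_on_prod_list_diff[OF phi])
      show "nonneg_on f' (vl_pow (c k) (r k) - s k *\<^sub>R 1)" if "k < n" for k
        using nonneg_on_vl_pow_diff[OF phi wgm c[OF that] _ r[OF that] lower[OF that]] r[OF that] s[OF that]
        by (simp add: powr_powr)
    qed (use f' s vl_pow_nonneg[OF phi wgm c] in auto)
    moreover have "nonneg_on f' (((\<Prod>k<n. s k) + \<delta> - G) *\<^sub>R 1)"
      using f' prod phi_one_nonneg[OF phi]
      by (intro nonneg_on_nonneg scaleR_nonneg_nonneg) (auto simp: G_def)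
    ultimately have "nonneg_on f' ((G *\<^sub>R 1 - x) + (?R - (\<Prod>k<n. s k) *\<^sub>R 1) + ((\<Prod>k<n. s k) + \<delta> - G) *\<^sub>R 1)"
      by (intro nonneg_on_add)
    then have "nonneg_on f' (?R - x + \<delta> *\<^sub>R 1)"
      by (simp add: algebra_simps)
    then show ?thesis using f' by blast
  qed
  then have "0 \<le> ?R - x" by (rule nonneg_if_locally_nonneg[OF phi])
  then show ?thesis by simp
qed

section \<open>Hoelder inequalities for real positive linear maps\<close>

lemma linear_prod_le_weighted_sum:
  fixes T :: "'a::{ordered_real_vector,lattice,real_algebra,monoid_mult} \<Rightarrow> 'b::{ordered_real_vector,lattice}"
  assumes phi: "phi_algebra_R TYPE('a)" and wgm: "wgm_closed_R TYPE('a)"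
    and T: "linear T" and T_nonneg: "\<And>x. 0 \<le> x \<Longrightarrow> 0 \<le> T x"
    and "\<And>k. k < n \<Longrightarrow> 0 \<le> b k" "\<And>k. k < n \<Longrightarrow> 0 < p k" "(\<Sum>k<n. 1 / p k) = 1"
    and "\<And>k. k < n \<Longrightarrow> 0 < \<theta> k" "(\<Prod>k<n. \<theta> k powr (1 / p k)) = 1"
  shows "T (prod_list (map b [0..<n])) \<le> (\<Sum>k<n. (1 / p k * \<theta> k) *\<^sub>R T (vl_pow (b k) (p k)))"
proof -
  let ?R = "\<Sum>k<n. (1 / p k * \<theta> k) *\<^sub>R vl_pow (b k) (p k)"
  have "prod_list (map b [0..<n]) \<le> ?R"
    by (intro prod_le_weighted_sum_vl_pow phi wgm assms(5-9))
  then have "0 \<le> T (?R - prod_list (map b [0..<n]))"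
    by (intro T_nonneg) simp
  also have "\<dots> = T ?R - T (prod_list (map b [0..<n]))"
    by (rule linear_diff[OF T])
  also have "T ?R = (\<Sum>k<n. (1 / p k * \<theta> k) *\<^sub>R T (vl_pow (b k) (p k)))"
    by (simp only: linear_sum[OF T] linear_scale[OF T])
  finally show ?thesis by simp
qed

text \<open>The images under \<open>T\<close> of the weighted sums bound \<open>T\<close> of the
  product for every admissible \<open>\<theta>\<close>, which is the premise of the comparison in
  the codomain with weights \<open>1 / p k\<close>.\<close>

lemma holder_prod:
  fixes T :: "'a::{ordered_real_vector,lattice,real_algebra,monoid_mult} \<Rightarrow>
    'b::{ordered_real_vector,lattice,real_algebra,monoid_mult}"
  assumes "phi_algebra_R TYPE('a)" "wgm_closed_R TYPE('a)"
    and "phi_algebra_R TYPE('b)" "wgm_closed_R TYPE('b)"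
    and "linear T" "\<And>x. 0 \<le> x \<Longrightarrow> 0 \<le> T x"
    and b: "\<And>k. k < n \<Longrightarrow> 0 \<le> b k" and p: "\<And>k. k < n \<Longrightarrow> 0 < p k" and "(\<Sum>k<n. 1 / p k) = 1"
  shows "T (prod_list (map b [0..<n]))
    \<le> prod_list (map (\<lambda>k. vl_pow (T (vl_pow (b k) (p k))) (1 / p k)) [0..<n])"
proof (rule weighted_inf_le_prod_vl_pow)
  show "0 \<le> T (vl_pow (b k) (p k))" if "k < n" for k
    by (intro assms(6) vl_pow_nonneg assms(1,2) b that)
  show "T (prod_list (map b [0..<n])) \<le> (\<Sum>k<n. (1 / p k * \<theta> k) *\<^sub>R T (vl_pow (b k) (p k)))"
    if "\<And>k. k < n \<Longrightarrow> 0 < \<theta> k" "(\<Prod>k<n. \<theta> k powr (1 / p k)) = 1" for \<theta>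
    by (intro linear_prod_le_weighted_sum assms that)
qed (use assms in auto)

lemma vl_is_inf_wgm_R:
  fixes f :: "nat \<Rightarrow> 'a::{ordered_real_vector,lattice}"
  assumes wgm: "wgm_closed_R TYPE('a)" and p: "\<And>k. k < n \<Longrightarrow> 1 < p k" and p1: "(\<Sum>k<n. 1 / p k) = 1"
  shows "vl_is_inf (wgm_set_R n f (\<lambda>k. 1 / p k)) (wgm_R n f (\<lambda>k. 1 / p k))"
proof -
  have "\<forall>k<n. 0 < 1 / p k \<and> 1 / p k < 1"
    using p by (fastforce simp: field_simps)
  then obtain x where "vl_is_inf (wgm_set_R n f (\<lambda>k. 1 / p k)) x"
    using wgm[unfolded wgm_closed_R_def, rule_format, of n "\<lambda>k. 1 / p k" f] p1 by blast
  then show ?thesis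
    by (simp add: wgm_R_def vl_Inf_eqI)
qed

text \<open>\<open>T\<close> of the product is a lower bound of the set defining the mean, whose
  absolute values disappear because each \<open>T (vl_pow (b k) (p k))\<close> is
  nonnegative.\<close>

lemma holder_wgm:
  fixes T :: "'a::{ordered_real_vector,lattice,real_algebra,monoid_mult} \<Rightarrow> 'b::{ordered_real_vector,lattice}"
  assumes phi: "phi_algebra_R TYPE('a)" and wgm: "wgm_closed_R TYPE('a)" "wgm_closed_R TYPE('b)"
    and T: "linear T" and T_nonneg: "\<And>x. 0 \<le> x \<Longrightarrow> 0 \<le> T x"
    and b: "\<And>k. k < n \<Longrightarrow> 0 \<le> b k" and p: "\<And>k. k < n \<Longrightarrow> 1 < p k" and p1: "(\<Sum>k<n. 1 / p k) = 1"
  shows "T (prod_list (map b [0..<n])) \<le> wgm_R n (\<lambda>k. T (vl_pow (b k) (p k))) (\<lambda>k. 1 / p k)"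
proof -
  let ?f = "\<lambda>k. T (vl_pow (b k) (p k))"
  have p0: "0 < p k" if "k < n" for k using p[OF that] by simp
  have "T (prod_list (map b [0..<n])) \<le> x" if x: "x \<in> wgm_set_R n ?f (\<lambda>k. 1 / p k)" for x
  proof -
    obtain \<theta> where x_eq: "x = (\<Sum>k<n. (1 / p k * \<theta> k) *\<^sub>R vl_abs (?f k))" and \<theta>: "\<forall>k<n. 0 < \<theta> k"
      "(\<Prod>k<n. \<theta> k powr (1 / p k)) = 1"
      using x unfolding wgm_set_R_def by blast
    have "(\<Sum>k<n. (1 / p k * \<theta> k) *\<^sub>R ?f k) = x"
      unfolding x_eq by (intro sum.cong refl)
        (simp add: vl_abs_of_nonneg T_nonneg vl_pow_nonneg[OF phi wgm(1)] b)
    moreover have "T (prod_list (map b [0..<n])) \<le> (\<Sum>k<n. (1 / p k * \<theta> k) *\<^sub>R ?f k)"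
      using \<theta> by (intro linear_prod_le_weighted_sum phi wgm(1) T T_nonneg b p0 p1) auto
    ultimately show ?thesis by (simp only:)
  qed
  then show ?thesis
    using vl_is_inf_wgm_R[where f = ?f, OF wgm(2) p p1] unfolding vl_is_inf_def by blast
qed

section \<open>Reduction of the complex case to the real case\<close>

lemma vl_is_sup_unique: "vl_is_sup S x \<Longrightarrow> vl_is_sup S y \<Longrightarrow> x = y"
  unfolding vl_is_sup_def by (intro antisym) auto

lemma vl_Sup_eqI: "vl_is_sup S x \<Longrightarrow> vl_Sup S = x"
  unfolding vl_Sup_def by (blast intro: vl_is_sup_unique)

text \<open>The cosine is bounded by 1 in absolute value, and the angles 0 and pi yield
  \<open>x\<close> and \<open>- x\<close>.\<close>

lemma c_abs_real: "c_abs (x, 0) = (vl_abs x, 0)" for x :: "'a::{ordered_real_vector,lattice}"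
proof -
  let ?S = "{cos t *\<^sub>R x + sin t *\<^sub>R 0 | t. 0 \<le> t \<and> t \<le> 2 * pi}"
  have "vl_is_sup ?S (vl_abs x)"
    unfolding vl_is_sup_def
  proof (intro conjI ballI allI impI)
    fix s assume "s \<in> ?S"
    then obtain t where s: "s = cos t *\<^sub>R x" by auto
    have "\<bar>cos t\<bar> *\<^sub>R vl_abs x \<le> 1 *\<^sub>R vl_abs x"
      by (intro scaleR_right_mono vl_abs_nonneg) auto
    moreover have "s \<le> \<bar>cos t\<bar> *\<^sub>R vl_abs x"
    proof (cases "0 \<le> cos t")
      case True
      then show ?thesis unfolding s
        using scaleR_left_mono[of x "vl_abs x" "cos t"] by (simp add: vl_abs_def)
    next
      case False
      then show ?thesis unfolding s
        using scaleR_left_mono[of "- x" "vl_abs x" "- cos t"] by (simp add: vl_abs_def)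
    qed
    ultimately show "s \<le> vl_abs x" by simp
  next
    fix z assume z: "\<forall>s\<in>?S. s \<le> z"
    have "cos 0 *\<^sub>R x + sin 0 *\<^sub>R 0 \<in> ?S" "cos pi *\<^sub>R x + sin pi *\<^sub>R 0 \<in> ?S"
      using pi_ge_zero by fastforce+
    then have "x \<le> z" "- x \<le> z" using z by fastforce+
    then show "vl_abs x \<le> z" by (simp add: vl_abs_def)
  qed
  then show ?thesis by (simp add: c_abs_def vl_Sup_eqI)
qed

text \<open>The second component of a modulus is 0 by definition, so its fixed points are
  real.\<close>

lemma c_pos_iff: "c_pos x \<longleftrightarrow> snd x = 0 \<and> 0 \<le> fst x"
proof -
  have "snd x = 0" if "c_pos x"
  proof -
    have "snd (c_abs x) = snd x" using that by (simp add: c_pos_def)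
    then show ?thesis by (simp add: c_abs_def)
  qed
  then show ?thesis
    by (cases x) (auto simp: c_pos_def c_abs_real vl_abs_eq_iff)
qed

lemma c_le_iff: "c_le x y \<longleftrightarrow> snd x = snd y \<and> fst x \<le> fst y"
  by (auto simp: c_le_def c_pos_iff c_sub_def)

lemma c_abs_nonneg:
  fixes x :: "'a::{ordered_real_vector,lattice} \<times> 'a"
  assumes "complex_vl TYPE('a)"
  shows "0 \<le> fst (c_abs x)"
proof -
  let ?S = "{cos t *\<^sub>R fst x + sin t *\<^sub>R snd x | t. 0 \<le> t \<and> t \<le> 2 * pi}"
  obtain s where s: "vl_is_sup ?S s"
    using assms unfolding complex_vl_def by blast
  have "cos 0 *\<^sub>R fst x + sin 0 *\<^sub>R snd x \<in> ?S" "cos pi *\<^sub>R fst x + sin pi *\<^sub>R snd x \<in> ?S"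
    using pi_ge_zero by fastforce+
  then have "fst x \<le> s" "- fst x \<le> s"
    using s unfolding vl_is_sup_def by fastforce+
  then have "vl_abs (fst x) \<le> s" by (simp add: vl_abs_def)
  then have "0 \<le> s" using vl_abs_nonneg order_trans by blast
  then show ?thesis by (simp add: c_abs_def vl_Sup_eqI[OF s])
qed

text \<open>Comparable elements have equal imaginary parts. A member of the nonempty
  \<open>S\<close> therefore makes every lower bound real.\<close>

lemma c_is_inf_real_iff:
  assumes "S \<noteq> {}"
  shows "c_is_inf ((\<lambda>s. (s, 0)) ` S) x \<longleftrightarrow> snd x = 0 \<and> vl_is_inf S (fst x)"
  using assms unfolding c_is_inf_def vl_is_inf_def c_le_iff by fastforce

lemma c_Inf_real:
  assumes "S \<noteq> {}" "vl_is_inf S m"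
  shows "c_Inf ((\<lambda>s. (s, 0)) ` S) = (m, 0)"
  unfolding c_Inf_def c_is_inf_real_iff[OF assms(1)]
  using assms(2) vl_is_inf_unique by (intro the_equality) (auto simp: prod_eq_iff)

lemma wgm_set_C_real:
  "wgm_set_C n (\<lambda>k. (f k, 0)) r = (\<lambda>s. (s, 0)) ` wgm_set_R n f r"
  unfolding wgm_set_C_def wgm_set_R_def c_abs_real
  by (auto simp: c_sum_def c_scaleR_def image_iff)

lemma wgm_set_R_nonempty: "wgm_set_R n f r \<noteq> {}"
  unfolding wgm_set_R_def by (auto intro!: exI[of _ "\<lambda>_. 1"])

lemma wgm_closed_R_if_C:
  assumes "wgm_closed_C TYPE('a::{ordered_real_vector,lattice})"
  shows "wgm_closed_R TYPE('a)"
  unfolding wgm_closed_R_def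
proof (intro allI impI)
  fix n and f :: "nat \<Rightarrow> 'a" and r :: "nat \<Rightarrow> real"
  assume "(\<forall>k<n. 0 < r k \<and> r k < 1) \<and> (\<Sum>k<n. r k) = 1"
  then obtain x where "c_is_inf (wgm_set_C n (\<lambda>k. (f k, 0)) r) x"
    using assms unfolding wgm_closed_C_def by blast
  then show "\<exists>x. vl_is_inf (wgm_set_R n f r) x"
    unfolding wgm_set_C_real c_is_inf_real_iff[OF wgm_set_R_nonempty] by blast
qed

lemma c_mul_real: "c_mul (x, 0) (y, 0) = (x * y, 0)"
  by (simp add: c_mul_def)

lemma c_prod_list_real: "c_prod_list (map (\<lambda>k. (y k, 0)) ks) = (prod_list (map y ks), 0)"
  by (induction ks) (auto simp: c_prod_list_def c_one_def c_mul_real)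

lemma c_power_real: "c_power (x, 0) m = (x ^ m, 0)"
  by (induction m) (auto simp: c_power_def c_one_def c_mul_real)

lemma root_set_nonempty: "root_set b s \<noteq> {}"
  unfolding root_set_def by (auto intro!: exI[of _ 1])

lemma c_pow_real:
  fixes b :: "'a::{ordered_real_vector,lattice,real_algebra,monoid_mult}"
  assumes phi: "phi_algebra_R TYPE('a)" and wgm: "wgm_closed_R TYPE('a)" and b: "0 \<le> b"
  shows "c_pow (b, 0) r = (vl_pow b r, 0)"
proof (cases "frac r = 0")
  case True
  then show ?thesis by (simp add: c_pow_def vl_pow_def c_power_real c_one_def c_mul_real)
next
  case False
  then have s: "0 < frac r" "frac r < 1"
    using frac_ge_0[of r] frac_lt_1[of r] by linarith+
  obtain g where g: "vl_is_inf (root_set b (frac r)) g"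
    using ex_inf_root_set[OF phi wgm b s] by blast
  have "{c_add (c_scaleR (frac r * \<theta>1) (b, 0)) (c_scaleR ((1 - frac r) * \<theta>2) c_one) | \<theta>1 \<theta>2.
      0 < \<theta>1 \<and> 0 < \<theta>2 \<and> \<theta>1 powr frac r * \<theta>2 powr (1 - frac r) = 1}
    = (\<lambda>s. (s, 0)) ` root_set b (frac r)"
    unfolding root_set_def c_add_def c_scaleR_def c_one_def by (auto simp: image_iff)
  then have "c_pow (b, 0) r = c_mul (c_power (b, 0) (nat \<lfloor>r\<rfloor>)) (g, 0)"
    using False by (simp only: c_pow_def if_False c_Inf_real[OF root_set_nonempty g])
  then show ?thesis
    by (simp add: c_power_real c_mul_real vl_pow_eq[OF g False])
qed

text \<open>Positivity makes the images of positive elements real. A real \<open>x\<close> is the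
  difference of its positive and negative parts, so its image is real too and \<open>S\<close> is
  the restriction of \<open>T\<close>.\<close>

lemma c_positive_linear_real:
  fixes T :: "'a::{ordered_real_vector,lattice} \<times> 'a \<Rightarrow> 'b::{ordered_real_vector,lattice} \<times> 'b"
  assumes lin: "c_linear T" and pos: "c_positive T"
  obtains S where "linear S" "\<And>x. 0 \<le> x \<Longrightarrow> 0 \<le> S x" "\<And>x. T (x, 0) = (S x, 0)"
proof
  let ?S = "\<lambda>x. fst (T (x, 0))"
  have pos: "snd (T (x, 0)) = 0 \<and> 0 \<le> ?S x" if "0 \<le> x" for x
    using pos that unfolding c_positive_def c_pos_iff by auto
  have add: "T (x + y, 0) = c_add (T (x, 0)) (T (y, 0))" for x y
    using lin unfolding c_linear_def by (metis c_add_def fst_conv snd_conv add_0)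
  have scale: "T (c *\<^sub>R x, 0) = c_smul (of_real c) (T (x, 0))" for c x
  proof -
    have "c_smul (of_real c) (x, 0) = (c *\<^sub>R x, 0)" by (simp add: c_smul_def)
    then show ?thesis using lin unfolding c_linear_def by metis
  qed
  show "linear ?S"
    by (rule linearI) (auto simp: add scale c_add_def c_smul_def)
  show "0 \<le> ?S x" if "0 \<le> x" for x using pos[OF that] by blast
  show "T (x, 0) = (?S x, 0)" for x
  proof -
    have "T (npart (- x), 0) = T (npart x + x, 0)"
      using ppart_minus_npart[of x] by (metis add.commute diff_add_cancel)
    then have "snd (T (npart (- x), 0)) = snd (T (npart x, 0)) + snd (T (x, 0))"
      by (simp add: add c_add_def)
    then show ?thesis
      using pos[OF npart_nonneg[of x]] pos[OF npart_nonneg[of "- x"]] by (simp add: prod_eq_iff)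
  qed
qed

text \<open>All elements in the inequality are built from moduli, which are real and nonnegative, so
  it is the real inequality for the restriction of \<open>T\<close>.\<close>

lemma holder_prod_complex:
  fixes T :: "'a::{ordered_real_vector,lattice,real_algebra,monoid_mult} \<times> 'a \<Rightarrow>
    'b::{ordered_real_vector,lattice,real_algebra,monoid_mult} \<times> 'b"
  assumes A: "phi_algebra_C TYPE('a)" "wgm_closed_C TYPE('a)"
    and B: "phi_algebra_C TYPE('b)" "wgm_closed_C TYPE('b)"
    and T: "c_linear T" "c_positive T"
    and p: "\<And>k. k < n \<Longrightarrow> 0 < p k" and p1: "(\<Sum>k<n. 1 / p k) = 1"
  shows "c_le (T (c_prod_list (map (\<lambda>k. c_abs (a k)) [0..<n])))
    (c_prod_list (map (\<lambda>k. c_pow (T (c_pow (c_abs (a k)) (p k))) (1 / p k)) [0..<n]))"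
proof -
  have phi: "phi_algebra_R TYPE('a)" "complex_vl TYPE('a)" "phi_algebra_R TYPE('b)"
    using A(1) B(1) by (auto simp: phi_algebra_C_def)
  note wgm = wgm_closed_R_if_C[OF A(2)] wgm_closed_R_if_C[OF B(2)]
  obtain S where S: "linear S" "\<And>x. 0 \<le> x \<Longrightarrow> 0 \<le> S x" "\<And>x. T (x, 0) = (S x, 0)"
    using c_positive_linear_real[OF T] by metis
  define b where "b k = fst (c_abs (a k))" for k
  have b: "c_abs (a k) = (b k, 0)" "0 \<le> b k" for k
    using c_abs_nonneg[OF phi(2)] by (simp_all add: b_def c_abs_def)
  have Tb: "c_pow (T (c_pow (b k, 0) (p k))) (1 / p k)
      = (vl_pow (S (vl_pow (b k) (p k))) (1 / p k), 0)" for k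
    using c_pow_real[OF phi(1) wgm(1) b(2)]
      c_pow_real[OF phi(3) wgm(2) S(2)[OF vl_pow_nonneg[OF phi(1) wgm(1) b(2)]]]
    by (simp add: S(3))
  show ?thesis
    unfolding b(1) Tb c_prod_list_real S(3) c_le_iff
    by (auto intro!: holder_prod phi wgm S(1,2) b(2) p p1)
qed

lemma holder_wgm_complex:
  fixes T :: "'a::{ordered_real_vector,lattice,real_algebra,monoid_mult} \<times> 'a \<Rightarrow>
    'b::{ordered_real_vector,lattice} \<times> 'b"
  assumes A: "phi_algebra_C TYPE('a)" "wgm_closed_C TYPE('a)" and B: "wgm_closed_C TYPE('b)"
    and T: "c_linear T" "c_positive T"
    and p: "\<And>k. k < n \<Longrightarrow> 1 < p k" and p1: "(\<Sum>k<n. 1 / p k) = 1"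
  shows "c_le (T (c_prod_list (map (\<lambda>k. c_abs (a k)) [0..<n])))
    (wgm_C n (\<lambda>k. T (c_pow (c_abs (a k)) (p k))) (\<lambda>k. 1 / p k))"
proof -
  have phi: "phi_algebra_R TYPE('a)" "complex_vl TYPE('a)"
    using A(1) by (auto simp: phi_algebra_C_def)
  note wgm = wgm_closed_R_if_C[OF A(2)] wgm_closed_R_if_C[OF B]
  obtain S where S: "linear S" "\<And>x. 0 \<le> x \<Longrightarrow> 0 \<le> S x" "\<And>x. T (x, 0) = (S x, 0)"
    using c_positive_linear_real[OF T] by metis
  define b where "b k = fst (c_abs (a k))" for k
  have b: "c_abs (a k) = (b k, 0)" "0 \<le> b k" for k
    using c_abs_nonneg[OF phi(2)] by (simp_all add: b_def c_abs_def)
  have Tb: "T (c_pow (b k, 0) (p k)) = (S (vl_pow (b k) (p k)), 0)" for k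
    using c_pow_real[OF phi(1) wgm(1) b(2)] by (simp add: S(3))
  have wgm_eq: "wgm_C n (\<lambda>k. (S (vl_pow (b k) (p k)), 0)) (\<lambda>k. 1 / p k)
      = (wgm_R n (\<lambda>k. S (vl_pow (b k) (p k))) (\<lambda>k. 1 / p k), 0)"
    unfolding wgm_C_def wgm_set_C_real
    by (intro c_Inf_real wgm_set_R_nonempty vl_is_inf_wgm_R wgm(2) p p1)
  show ?thesis
    unfolding b(1) Tb wgm_eq c_prod_list_real S(3) c_le_iff
    by (auto intro!: holder_wgm phi wgm S(1,2) b(2) p p1)
qed

theorem theorem4p7:
  fixes p :: "nat \<Rightarrow> real" and n :: nat
  assumes "\<forall>k<n. 1 < p k" and "(\<Sum>k<n. 1 / p k) = 1"
  shows
    \<comment> \<open>K = R, part (1)\<close>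
    "(phi_algebra_R TYPE('a::{ordered_real_vector,lattice,real_algebra,monoid_mult}) \<and> wgm_closed_R TYPE('a) \<and>
      phi_algebra_R TYPE('b::{ordered_real_vector,lattice,real_algebra,monoid_mult}) \<and> wgm_closed_R TYPE('b) \<longrightarrow>
      (\<forall>(T::'a \<Rightarrow> 'b) (a::nat \<Rightarrow> 'a). linear T \<and> positive_R T \<longrightarrow>
         T (prod_list (map (\<lambda>k. vl_abs (a k)) [0..<n]))
           \<le> prod_list (map (\<lambda>k. vl_pow (T (vl_pow (vl_abs (a k)) (p k))) (1 / p k)) [0..<n]))) \<and>
     \<comment> \<open>K = R, part (2)\<close>
     (phi_algebra_R TYPE('a) \<and> wgm_closed_R TYPE('a) \<and>
      archimedean_vl TYPE('c::{ordered_real_vector,lattice}) \<and> wgm_closed_R TYPE('c) \<longrightarrow>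
      (\<forall>(T::'a \<Rightarrow> 'c) (a::nat \<Rightarrow> 'a). linear T \<and> positive_R T \<longrightarrow>
         T (prod_list (map (\<lambda>k. vl_abs (a k)) [0..<n]))
           \<le> wgm_R n (\<lambda>k. T (vl_pow (vl_abs (a k)) (p k))) (\<lambda>k. 1 / p k))) \<and>
     \<comment> \<open>K = C, part (1)\<close>
     (phi_algebra_C TYPE('a) \<and> wgm_closed_C TYPE('a) \<and>
      phi_algebra_C TYPE('b) \<and> wgm_closed_C TYPE('b) \<longrightarrow>
      (\<forall>(T::'a \<times> 'a \<Rightarrow> 'b \<times> 'b) (a::nat \<Rightarrow> 'a \<times> 'a). c_linear T \<and> c_positive T \<longrightarrow>
         c_le (T (c_prod_list (map (\<lambda>k. c_abs (a k)) [0..<n])))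
              (c_prod_list (map (\<lambda>k. c_pow (T (c_pow (c_abs (a k)) (p k))) (1 / p k)) [0..<n])))) \<and>
     \<comment> \<open>K = C, part (2)\<close>
     (phi_algebra_C TYPE('a) \<and> wgm_closed_C TYPE('a) \<and>
      complex_vl TYPE('c) \<and> wgm_closed_C TYPE('c) \<longrightarrow>
      (\<forall>(T::'a \<times> 'a \<Rightarrow> 'c \<times> 'c) (a::nat \<Rightarrow> 'a \<times> 'a). c_linear T \<and> c_positive T \<longrightarrow>
         c_le (T (c_prod_list (map (\<lambda>k. c_abs (a k)) [0..<n])))
              (wgm_C n (\<lambda>k. T (c_pow (c_abs (a k)) (p k))) (\<lambda>k. 1 / p k))))"
proof -
  have p: "\<And>k. k < n \<Longrightarrow> 1 < p k" and p0: "\<And>k. k < n \<Longrightarrow> 0 < p k"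
    using assms(1) by force+
  note p1 = assms(2)
  show ?thesis
  proof (intro conjI impI allI)
    fix T :: "'a \<Rightarrow> 'b" and a :: "nat \<Rightarrow> 'a"
    assume "phi_algebra_R TYPE('a) \<and> wgm_closed_R TYPE('a) \<and> phi_algebra_R TYPE('b) \<and> wgm_closed_R TYPE('b)"
      and "linear T \<and> positive_R T"
    then show "T (prod_list (map (\<lambda>k. vl_abs (a k)) [0..<n]))
        \<le> prod_list (map (\<lambda>k. vl_pow (T (vl_pow (vl_abs (a k)) (p k))) (1 / p k)) [0..<n])"
      \<comment> \<open>\<open>positive_R\<close> is phrased with fixed points of the absolute
        value, which are the nonnegative elements.\<close>
      by (intro holder_prod vl_abs_nonneg p0 p1) (auto simp: positive_R_def vl_abs_eq_iff)
  next
    fix T :: "'a \<Rightarrow> 'c" and a :: "nat \<Rightarrow> 'a"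
    assume "phi_algebra_R TYPE('a) \<and> wgm_closed_R TYPE('a) \<and> archimedean_vl TYPE('c) \<and> wgm_closed_R TYPE('c)"
      and "linear T \<and> positive_R T"
    then show "T (prod_list (map (\<lambda>k. vl_abs (a k)) [0..<n]))
        \<le> wgm_R n (\<lambda>k. T (vl_pow (vl_abs (a k)) (p k))) (\<lambda>k. 1 / p k)"
      by (intro holder_wgm vl_abs_nonneg p p1) (auto simp: positive_R_def vl_abs_eq_iff)
  qed (use p p0 p1 in \<open>auto intro: holder_prod_complex holder_wgm_complex\<close>)
qed

end
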